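(* Let $G$ be a finite group. Then $G$ is abelian if and only if $\mathrm{anz}(G) < \frac{1}{3}$.
   Context: For a finite group $G$, $\mathrm{Irr}(G)$ denotes the set of complex irreducible characters of $G$. $\mathrm{nz}(G)$ denotes the number of zeros in the character table of $G$, i.e. the number of pairs $(\chi, C)$ with $\chi\in\mathrm{Irr}(G)$ and $C$ a conjugacy class of $G$ such that $\chi$ is $0$ on $C$. The average number of zeros of characters of $G$ is $\mathrm{anz}(G) := \mathrm{nz}(G)/|\mathrm{Irr}(G)|$. *)

theory Defs
  imports
    "HOL-Algebra.Group_Action"
    "Jordan_Normal_Form.VS_Connect"
begin

definition GL_complex :: "nat \<Rightarrow> complex mat monoid" where
  "GL_complex n = units_of (ring_mat TYPE(complex) n ())"

definition complex_rep :: "('a, 'b) monoid_scheme \<Rightarrow> nat \<Rightarrow> ('a \<Rightarrow> complex mat) \<Rightarrow> bool" where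
  "complex_rep G n \<rho> \<longleftrightarrow> \<rho> \<in> hom G (GL_complex n)"

definition invariant_subspace ::
    "('a, 'b) monoid_scheme \<Rightarrow> nat \<Rightarrow> ('a \<Rightarrow> complex mat) \<Rightarrow> complex vec set \<Rightarrow> bool" where
  "invariant_subspace G n \<rho> W \<longleftrightarrow>
     subspace class_ring W (module_vec TYPE(complex) n) \<and>
     (\<forall>g\<in>carrier G. \<forall>w\<in>W. \<rho> g *\<^sub>v w \<in> W)"

text \<open>The zero-dimensional representation is not irreducible.\<close>

definition irreducible_rep :: "('a, 'b) monoid_scheme \<Rightarrow> nat \<Rightarrow> ('a \<Rightarrow> complex mat) \<Rightarrow> bool" where
  "irreducible_rep G n \<rho> \<longleftrightarrow>
     complex_rep G n \<rho> \<and> n > 0 \<and>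
     (\<forall>W. invariant_subspace G n \<rho> W \<longrightarrow> W = {0\<^sub>v n} \<or> W = carrier_vec n)"

definition mat_trace :: "complex mat \<Rightarrow> complex" where
  "mat_trace A = (\<Sum>i<dim_row A. A $$ (i, i))"

text \<open>
  Characters are restricted to the carrier (with value \<^term>\<open>undefined\<close> outside), so that
  two characters are equal as HOL functions exactly if they agree on the group. Hence
  \<open>Irr G\<close> counts each irreducible character once, although equivalent
  representations give the same character.
\<close>

definition rep_character :: "('a, 'b) monoid_scheme \<Rightarrow> ('a \<Rightarrow> complex mat) \<Rightarrow> 'a \<Rightarrow> complex" where
  "rep_character G \<rho> = (\<lambda>g\<in>carrier G. mat_trace (\<rho> g))"

definition Irr :: "('a, 'b) monoid_scheme \<Rightarrow> ('a \<Rightarrow> complex) set" where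
  "Irr G = {rep_character G \<rho> | n \<rho>. irreducible_rep G n \<rho>}"

definition conj_classes :: "('a, 'b) monoid_scheme \<Rightarrow> 'a set set" where
  "conj_classes G =
     orbits G (carrier G) (\<lambda>g. \<lambda>h\<in>carrier G. g \<otimes>\<^bsub>G\<^esub> h \<otimes>\<^bsub>G\<^esub> inv\<^bsub>G\<^esub> g)"

definition nz :: "('a, 'b) monoid_scheme \<Rightarrow> nat" where
  "nz G = card {(\<chi>, C). \<chi> \<in> Irr G \<and> C \<in> conj_classes G \<and> (\<forall>g\<in>C. \<chi> g = 0)}"

definition anz :: "('a, 'b) monoid_scheme \<Rightarrow> real" where
  "anz G = real (nz G) / real (card (Irr G))"

end

theory Submission
  imports
    Defs
    "HOL-Algebra.Multiplicative_Group"
    "HOL-Number_Theory.Totient"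
    "Jordan_Normal_Form.DL_Rank"
    "Jordan_Normal_Form.Schur_Decomposition"
begin

text \<open>
  An irreducible representation of an abelian group is scalar by Schur's lemma, so its character has
  no zeros. Conversely let \<open>G\<close> be nonabelian with \<open>k\<close> irreducible characters, \<open>a\<close> of them linear. By
  Burnside's theorem each nonlinear character vanishes somewhere, so \<open>nz G \<ge> k - a\<close>. Now fix one
  nonlinear character \<open>\<chi>\<close> and let the linear characters act on it by multiplication. If \<open>m\<close> linear
  characters send \<open>\<chi>\<close> to the same \<open>\<psi>\<close>, they agree off the zeros of \<open>\<chi>\<close>, and Bessel's inequality shows
  that \<open>\<chi>\<close>, hence also \<open>\<psi>\<close>, vanishes on at least \<open>m - 1\<close> classes. Summing over the orbit, which has at
  most \<open>k - a\<close> members, gives \<open>nz G \<ge> a - (k - a) = 2 a - k\<close>. Adding this to twice the first bound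
  yields \<open>3 nz G \<ge> k\<close>. The number of conjugacy classes never has to be compared with \<open>k\<close>.
\<close>

text \<open>The bound is attained by the symmetric group on three letters, with three irreducible
  characters and a single zero: there \<open>a = 2\<close> and \<open>k = 3\<close>, so both
  estimates are equalities.

  The count \<open>m - 1\<close> is at heart a dimension bound. Divided by one of their number, the
  \<open>m\<close> linear characters become independent functions that are constant on each of the
  \<open>z\<close> zero classes of \<chi> and on the complement of their union, so they live in a
  space of dimension \<open>z + 1\<close>. Bessel's inequality, used one block at a time, is a
  quantitative form of this.

  Burnside's theorem needs an arithmetic input. For a group of order \<open>N\<close>, the values of
  a character at the powers of \<open>g\<close> are one integer polynomial evaluated at the powers
  of a primitive \<open>N\<close>-th root of unity. Raising group elements to powers prime to
  \<open>N\<close> thus acts as Galois conjugation, and sums over all conjugates are integers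
  because Ramanujan sums are.

  A nonabelian group has a nonlinear character because otherwise a nontrivial commutator would have
  trace equal to the degree in every representation, whereas its trace in the regular one is
  0.\<close>

hide_const (open) Polynomial.order

section \<open>Representations and Schur's lemma\<close>

lemma mat_trace_comm:
  assumes "A \<in> carrier_mat m n" "B \<in> carrier_mat n m"
  shows "mat_trace (A * B) = mat_trace (B * A)"
proof -
  have "mat_trace (A * B) = (\<Sum>i<m. \<Sum>j<n. A $$ (i, j) * B $$ (j, i))"
    using assms unfolding mat_trace_def
    by (intro sum.cong) (auto simp: scalar_prod_def lessThan_atLeast0)
  also have "\<dots> = (\<Sum>j<n. \<Sum>i<m. B $$ (j, i) * A $$ (i, j))"
    by (subst sum.swap) (simp add: mult.commute)
  also have "\<dots> = mat_trace (B * A)"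
    using assms unfolding mat_trace_def
    by (intro sum.cong) (auto simp: scalar_prod_def lessThan_atLeast0)
  finally show ?thesis .
qed

lemma mat_trace_one [simp]: "mat_trace (1\<^sub>m n) = of_nat n"
  by (simp add: mat_trace_def)

lemma mat_trace_smult: "A \<in> carrier_mat n n \<Longrightarrow> mat_trace (c \<cdot>\<^sub>m A) = c * mat_trace A"
  by (auto simp: mat_trace_def sum_distrib_left)

text \<open>Cyclicity of the trace. \<open>P\<close> and \<open>Q\<close> may be rectangular because
  an intertwiner between representations of degrees \<open>n\<close> and \<open>m\<close> is to be
  conjugated away before the two degrees are known to agree.\<close>

lemma mat_trace_conj:
  assumes "A \<in> carrier_mat n n" "P \<in> carrier_mat m n" "Q \<in> carrier_mat n m" "Q * P = 1\<^sub>m n"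
  shows "mat_trace (P * A * Q) = mat_trace A"
proof -
  have "mat_trace (P * A * Q) = mat_trace (Q * (P * A))"
    using assms by (intro mat_trace_comm) auto
  also have "Q * (P * A) = A"
    using assms by (metis assoc_mult_mat left_mult_one_mat)
  finally show ?thesis .
qed

context group
begin

text \<open>The matrix of \<open>inv g\<close> is a two-sided inverse of the matrix of
  \<open>g\<close>, so multiplicativity and the value at the identity already force
  invertibility.\<close>

lemma complex_repI:
  assumes "\<And>g. g \<in> carrier G \<Longrightarrow> \<rho> g \<in> carrier_mat n n"
    and "\<And>g h. g \<in> carrier G \<Longrightarrow> h \<in> carrier G \<Longrightarrow> \<rho> (g \<otimes> h) = \<rho> g * \<rho> h"
    and "\<rho> \<one> = 1\<^sub>m n"
  shows "complex_rep G n \<rho>"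
proof -
  have "\<rho> g \<in> Units (ring_mat TYPE(complex) n ())" if g: "g \<in> carrier G" for g
  proof -
    have "\<rho> g * \<rho> (inv g) = 1\<^sub>m n" "\<rho> (inv g) * \<rho> g = 1\<^sub>m n"
      using assms(2)[of g "inv g"] assms(2)[of "inv g" g] assms(3) g by auto
    then show ?thesis
      using assms(1)[OF g] assms(1)[of "inv g"] g by (auto simp: Units_def ring_mat_def)
  qed
  then show ?thesis
    using assms(2) by (auto simp: complex_rep_def hom_def GL_complex_def units_of_def ring_mat_def)
qed

lemma complex_repD:
  assumes "complex_rep G n \<rho>"
  shows "g \<in> carrier G \<Longrightarrow> \<rho> g \<in> carrier_mat n n"
    and "g \<in> carrier G \<Longrightarrow> h \<in> carrier G \<Longrightarrow> \<rho> (g \<otimes> h) = \<rho> g * \<rho> h"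
    and "\<rho> \<one> = 1\<^sub>m n"
proof -
  have U: "\<rho> g \<in> Units (ring_mat TYPE(complex) n ())" if "g \<in> carrier G" for g
    using assms that by (auto simp: complex_rep_def hom_def GL_complex_def units_of_def)
  show c: "\<rho> g \<in> carrier_mat n n" if "g \<in> carrier G" for g
    using U[OF that] by (auto simp: Units_def ring_mat_def)
  show m: "\<rho> (g \<otimes> h) = \<rho> g * \<rho> h" if "g \<in> carrier G" "h \<in> carrier G" for g h
    using assms that by (auto simp: complex_rep_def hom_def GL_complex_def units_of_def ring_mat_def)
  have "\<rho> \<one> \<in> Units (ring_mat TYPE(complex) n ())" using U by blast
  then obtain B where B: "B \<in> carrier_mat n n" "B * \<rho> \<one> = 1\<^sub>m n"
    by (auto simp: Units_def ring_mat_def)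
  \<comment> \<open>An invertible idempotent matrix is the identity.\<close>
  have "\<rho> \<one> * \<rho> \<one> = \<rho> \<one>" using m[of \<one> \<one>] by simp
  then have "B * (\<rho> \<one> * \<rho> \<one>) = 1\<^sub>m n" using B by simp
  then show "\<rho> \<one> = 1\<^sub>m n"
    using B c[of \<one>] by (metis assoc_mult_mat left_mult_one_mat one_closed)
qed

lemma complex_rep_inv:
  assumes "complex_rep G n \<rho>" "g \<in> carrier G"
  shows "\<rho> g * \<rho> (inv g) = 1\<^sub>m n" "\<rho> (inv g) * \<rho> g = 1\<^sub>m n"
  using complex_repD(2)[OF assms(1), of g "inv g"] complex_repD(2)[OF assms(1), of "inv g" g]
    complex_repD(3)[OF assms(1)] assms(2) by auto

lemma complex_rep_pow:
  assumes "complex_rep G n \<rho>" "g \<in> carrier G"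
  shows "\<rho> (g [^] (k::nat)) = \<rho> g ^\<^sub>m k"
proof (induction k)
  case 0
  then show ?case using complex_repD[OF assms(1)] assms(2) by auto
next
  case (Suc k)
  then show ?case using complex_repD(2)[OF assms(1)] assms(2) by simp
qed

end

lemma invariant_subspace_iff:
  "invariant_subspace G n \<rho> W \<longleftrightarrow>
     W \<subseteq> carrier_vec n \<and> 0\<^sub>v n \<in> W \<and> (\<forall>v\<in>W. \<forall>w\<in>W. v + w \<in> W) \<and> (\<forall>c. \<forall>v\<in>W. c \<cdot>\<^sub>v v \<in> W) \<and>
     (\<forall>g\<in>carrier G. \<forall>w\<in>W. \<rho> g *\<^sub>v w \<in> W)"
proof -
  have "VectorSpace.subspace class_ring W (module_vec TYPE(complex) n) \<longleftrightarrow>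
    W \<subseteq> carrier_vec n \<and> 0\<^sub>v n \<in> W \<and> (\<forall>v\<in>W. \<forall>w\<in>W. v + w \<in> W) \<and> (\<forall>c. \<forall>v\<in>W. c \<cdot>\<^sub>v v \<in> W)"
    using vec_vs[of n, where 'a=complex] vec_module[of n, where 'a=complex]
    unfolding VectorSpace.subspace_def submodule_def
    by (auto simp: module_vec_simps class_ring_simps)
  then show ?thesis by (auto simp: invariant_subspace_def)
qed

lemma mult_mat_vec_unit:
  fixes A :: "complex mat"
  assumes "A \<in> carrier_mat m n" "i < n"
  shows "A *\<^sub>v unit_vec n i = col A i"
  using assms by (intro eq_vecI) auto

context group
begin

lemma irreducible_repD:
  assumes "irreducible_rep G n \<rho>"
  shows "complex_rep G n \<rho>" "n > 0"
    "W \<subseteq> carrier_vec n \<Longrightarrow> 0\<^sub>v n \<in> W \<Longrightarrow> (\<And>v w. v \<in> W \<Longrightarrow> w \<in> W \<Longrightarrow> v + w \<in> W) \<Longrightarrow>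
     (\<And>c v. v \<in> W \<Longrightarrow> c \<cdot>\<^sub>v v \<in> W) \<Longrightarrow> (\<And>g v. g \<in> carrier G \<Longrightarrow> v \<in> W \<Longrightarrow> \<rho> g *\<^sub>v v \<in> W) \<Longrightarrow>
     W = {0\<^sub>v n} \<or> W = carrier_vec n"
proof -
  show "complex_rep G n \<rho>" "n > 0"
    using assms by (auto simp: irreducible_rep_def)
  assume "W \<subseteq> carrier_vec n" "0\<^sub>v n \<in> W" "\<And>v w. v \<in> W \<Longrightarrow> w \<in> W \<Longrightarrow> v + w \<in> W"
    "\<And>c v. v \<in> W \<Longrightarrow> c \<cdot>\<^sub>v v \<in> W" "\<And>g v. g \<in> carrier G \<Longrightarrow> v \<in> W \<Longrightarrow> \<rho> g *\<^sub>v v \<in> W"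
  then have "invariant_subspace G n \<rho> W" by (simp add: invariant_subspace_iff)
  then show "W = {0\<^sub>v n} \<or> W = carrier_vec n"
    using assms unfolding irreducible_rep_def by blast
qed

text \<open>The kernel of \<open>T\<close> is invariant under \<rho> and the image under \<sigma>;
  since \<open>T\<close> is nonzero, irreducibility leaves only the zero kernel and the full image.
  Bijectivity is delivered as an inverse matrix, the form needed for comparing traces.\<close>

lemma schur_lemma:
  assumes r: "irreducible_rep G n \<rho>" and s: "irreducible_rep G m \<sigma>"
    and T: "T \<in> carrier_mat m n" "T \<noteq> 0\<^sub>m m n"
    and comm: "\<And>g. g \<in> carrier G \<Longrightarrow> T * \<rho> g = \<sigma> g * T"
  shows "\<exists>R \<in> carrier_mat n m. T * R = 1\<^sub>m m \<and> R * T = 1\<^sub>m n"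
proof -
  note rD = complex_repD[OF irreducible_repD(1)[OF r]]
  note sD = complex_repD[OF irreducible_repD(1)[OF s]]
  let ?K = "{v \<in> carrier_vec n. T *\<^sub>v v = 0\<^sub>v m}"
  let ?I = "(\<lambda>v. T *\<^sub>v v) ` carrier_vec n"
  have ex: "\<exists>v \<in> carrier_vec n. T *\<^sub>v v \<noteq> 0\<^sub>v m"
  proof (rule ccontr)
    assume "\<not> ?thesis"
    then have *: "T *\<^sub>v v = 0\<^sub>v m" if "v \<in> carrier_vec n" for v using that by blast
    have "T = 0\<^sub>m m n"
    proof (rule eq_matI)
      fix i j assume ij: "i < dim_row (0\<^sub>m m n :: complex mat)" "j < dim_col (0\<^sub>m m n :: complex mat)"
      then have "(T *\<^sub>v unit_vec n j) $ i = T $$ (i, j)"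
        using T by (subst mult_mat_vec_unit) auto
      then show "T $$ (i, j) = 0\<^sub>m m n $$ (i, j)" using *[of "unit_vec n j"] ij by simp
    qed (use T in auto)
    with T show False by simp
  qed
  have com: "T *\<^sub>v (\<rho> g *\<^sub>v v) = \<sigma> g *\<^sub>v (T *\<^sub>v v)" if "g \<in> carrier G" "v \<in> carrier_vec n" for g v
    using comm[OF that(1)] T that rD(1) sD(1) by (metis assoc_mult_mat_vec)
  have "?K = {0\<^sub>v n} \<or> ?K = carrier_vec n"
  proof (rule irreducible_repD(3)[OF r])
    fix g v assume gv: "g \<in> carrier G" "v \<in> ?K"
    have "\<rho> g *\<^sub>v v \<in> carrier_vec n" "\<sigma> g *\<^sub>v 0\<^sub>v m = 0\<^sub>v m"
      using mult_mat_vec_carrier[OF rD(1)[OF gv(1)], of v] sD(1)[OF gv(1)] gv(2) by auto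
    then show "\<rho> g *\<^sub>v v \<in> ?K" using com[of g v] gv by auto
  qed (use T in \<open>auto simp: mult_add_distrib_mat_vec mult_mat_vec\<close>)
  with ex have K: "?K = {0\<^sub>v n}" by blast
  have "?I = {0\<^sub>v m} \<or> ?I = carrier_vec m"
  proof (rule irreducible_repD(3)[OF s])
    show "?I \<subseteq> carrier_vec m" using T by auto
    show "0\<^sub>v m \<in> ?I" using T by (intro image_eqI[of _ _ "0\<^sub>v n"]) auto
    fix g v assume gv: "g \<in> carrier G" "v \<in> ?I"
    then obtain u where u: "u \<in> carrier_vec n" "v = T *\<^sub>v u" by auto
    then have "\<sigma> g *\<^sub>v v = T *\<^sub>v (\<rho> g *\<^sub>v u)" using com gv by simp
    moreover have "\<rho> g *\<^sub>v u \<in> carrier_vec n" using mult_mat_vec_carrier[OF rD(1)[OF gv(1)]] u by blast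
    ultimately show "\<sigma> g *\<^sub>v v \<in> ?I" by blast
  next
    fix v w assume "v \<in> ?I" "w \<in> ?I"
    then obtain a b where "v = T *\<^sub>v a" "w = T *\<^sub>v b" "a \<in> carrier_vec n" "b \<in> carrier_vec n" by auto
    then show "v + w \<in> ?I" using T
      by (intro image_eqI[of _ _ "a + b"]) (auto simp: mult_add_distrib_mat_vec)
  next
    fix c v assume "v \<in> ?I"
    then obtain a where "v = T *\<^sub>v a" "a \<in> carrier_vec n" by auto
    then show "c \<cdot>\<^sub>v v \<in> ?I" using T
      by (intro image_eqI[of _ _ "c \<cdot>\<^sub>v a"]) (auto simp: mult_mat_vec)
  qed
  with ex have I: "?I = carrier_vec m" by blast
  \<comment> \<open>Preimages of the unit vectors, taken as columns, give a right inverse by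
    surjectivity.\<close>
  have "\<exists>u. u \<in> carrier_vec n \<and> T *\<^sub>v u = unit_vec m j" for j
  proof -
    have "unit_vec m j \<in> ?I" unfolding I by simp
    then show ?thesis by (metis (no_types, lifting) imageE)
  qed
  then obtain u where u: "u j \<in> carrier_vec n" "T *\<^sub>v u j = unit_vec m j" for j by metis
  define R where "R = mat_of_cols n (map u [0..<m])"
  have R: "R \<in> carrier_mat n m" using mat_of_cols_carrier(1)[of n "map u [0..<m]"] by (simp add: R_def)
  have TR: "T * R = 1\<^sub>m m"
  proof (rule mat_col_eqI)
    fix j assume "j < dim_col (1\<^sub>m m :: complex mat)"
    then have j: "j < m" by simp
    have "col (T * R) j = T *\<^sub>v col R j" using T R j by (intro col_mult2) auto
    also have "col R j = u j" using j u by (simp add: R_def)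
    finally show "col (T * R) j = col (1\<^sub>m m) j" using j u by simp
  qed (use T R in auto)
  have RT: "R * T = 1\<^sub>m n"
  proof (rule mat_col_eqI)
    fix j assume "j < dim_col (1\<^sub>m n :: complex mat)"
    then have j: "j < n" by simp
    let ?v = "unit_vec n j" let ?w = "R *\<^sub>v (T *\<^sub>v ?v)"
    have w: "?w \<in> carrier_vec n" using R T by auto
    \<comment> \<open>Since \<open>T * R\<close> is the identity, \<open>R * T\<close> moves a
      vector only by an element of the kernel of \<open>T\<close>, which is zero.\<close>
    have "T *\<^sub>v ?w = (T * R) *\<^sub>v (T *\<^sub>v ?v)" using T R by (subst assoc_mult_mat_vec) auto
    also have "\<dots> = T *\<^sub>v ?v" using TR T by simp
    finally have "T *\<^sub>v (?w - ?v) = 0\<^sub>v m"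
      using T w by (subst mult_minus_distrib_mat_vec) auto
    then have "?w - ?v \<in> ?K" using w by auto
    then have 0: "?w - ?v = 0\<^sub>v n" using K by blast
    have "?w = ?v"
    proof (rule eq_vecI)
      fix i assume "i < dim_vec ?v"
      then have "(?w - ?v) $ i = 0" "i < n" using 0 by auto
      then show "?w $ i = ?v $ i" using w by auto
    qed (use R w in auto)
    moreover have "?w = (R * T) *\<^sub>v ?v" using R T by (subst assoc_mult_mat_vec) auto
    ultimately have "(R * T) *\<^sub>v ?v = ?v" by metis
    moreover have "(R * T) *\<^sub>v ?v = col (R * T) j"
      by (rule mult_mat_vec_unit[OF mult_carrier_mat[OF R T(1)] j])
    ultimately show "col (R * T) j = col (1\<^sub>m n) j" using j by simp
  qed (use T R in auto)
  show ?thesis using R TR RT by blast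
qed

text \<open>Over the complex numbers \<open>T\<close> has an eigenvalue \<open>c\<close>. Then
  \<open>T - c\<close> still commutes with the representation but kills an eigenvector, so it is not
  invertible and must be zero.\<close>

lemma schur_lemma_scalar:
  assumes r: "irreducible_rep G n \<rho>" and T: "T \<in> carrier_mat n n"
    and comm: "\<And>g. g \<in> carrier G \<Longrightarrow> T * \<rho> g = \<rho> g * T"
  shows "\<exists>c. T = c \<cdot>\<^sub>m 1\<^sub>m n"
proof -
  note rD = complex_repD[OF irreducible_repD(1)[OF r]]
  have "degree (char_poly T) = n" using degree_monic_char_poly[OF T] by simp
  then have "\<not> constant (poly (char_poly T))"
    using irreducible_repD(2)[OF r] by (simp add: constant_degree)
  then obtain c where "poly (char_poly T) c = 0"
    using fundamental_theorem_of_algebra by blast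
  then have "eigenvalue T c" using eigenvalue_root_char_poly[OF T] by simp
  then obtain v where v: "v \<in> carrier_vec n" "v \<noteq> 0\<^sub>v n" "T *\<^sub>v v = c \<cdot>\<^sub>v v"
    using T by (auto simp: eigenvalue_def eigenvector_def)
  define S where "S = T - c \<cdot>\<^sub>m 1\<^sub>m n"
  have S: "S \<in> carrier_mat n n" unfolding S_def by (intro minus_carrier_mat) simp
  have Sv: "S *\<^sub>v v = 0\<^sub>v n"
    using v T unfolding S_def
    by (subst minus_mult_distrib_mat_vec[of _ n n]) auto
  have S0: "S = 0\<^sub>m n n"
  proof (rule ccontr)
    assume "S \<noteq> 0\<^sub>m n n"
    moreover have "S * \<rho> g = \<rho> g * S" if "g \<in> carrier G" for g
    proof -
      have "(c \<cdot>\<^sub>m 1\<^sub>m n) * \<rho> g = \<rho> g * (c \<cdot>\<^sub>m 1\<^sub>m n)"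
        using mult_smult_assoc_mat[of "1\<^sub>m n" n n "\<rho> g" n c] mult_smult_distrib[of "\<rho> g" n n "1\<^sub>m n" n c]
          rD(1)[OF that] by simp
      moreover have "c \<cdot>\<^sub>m 1\<^sub>m n \<in> carrier_mat n n" by simp
      ultimately show ?thesis unfolding S_def using T rD(1)[OF that] comm[OF that]
        by (metis minus_mult_distrib_mat mult_minus_distrib_mat)
    qed
    ultimately obtain R where R: "R \<in> carrier_mat n n" "R * S = 1\<^sub>m n"
      using schur_lemma[OF r r S] by blast
    then have "v = (R * S) *\<^sub>v v" using v by simp
    also have "\<dots> = R *\<^sub>v (S *\<^sub>v v)" using R S v by (subst assoc_mult_mat_vec) auto
    also have "\<dots> = 0\<^sub>v n" unfolding Sv using R by auto
    finally show False using v by simp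
  qed
  have 0: "S $$ (i, j) = 0" if "i < n" "j < n" for i j using that unfolding S0 by simp
  have "T = c \<cdot>\<^sub>m 1\<^sub>m n"
    using T 0 unfolding S_def by (intro eq_matI) auto
  then show ?thesis by blast
qed

end

section \<open>Orthogonality of characters\<close>

locale finite_group = group G for G (structure) +
  assumes finite_carrier: "finite (carrier G)"
begin

lemma order_pos: "order G > 0"
  using finite_carrier order_gt_0_iff_finite by blast

lemma sum_translate:
  assumes "h \<in> carrier G"
  shows "(\<Sum>g\<in>carrier G. f (h \<otimes> g)) = (\<Sum>g\<in>carrier G. f g)"
  using assms
  by (intro sum.reindex_bij_witness[of _ "\<lambda>g. inv h \<otimes> g" "\<lambda>g. h \<otimes> g"])
     (auto simp: m_assoc[symmetric])

text \<open>The group average of \<open>\<sigma> g * E i j * \<rho> (inv g)\<close> for the matrix unit \<open>E i j\<close>.\<close>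

definition averaged :: "nat \<Rightarrow> nat \<Rightarrow> ('a \<Rightarrow> complex mat) \<Rightarrow> ('a \<Rightarrow> complex mat) \<Rightarrow> nat \<Rightarrow> nat \<Rightarrow> complex mat" where
  "averaged m n \<sigma> \<rho> i j =
     mat m n (\<lambda>(k, l). \<Sum>g\<in>carrier G. \<sigma> g $$ (k, i) * \<rho> (inv g) $$ (j, l))"

text \<open>Substituting \<open>h \<otimes> g\<close> for \<open>g\<close> turns
  \<open>\<sigma> g\<close> into \<open>\<sigma> h * \<sigma> g\<close> and
  \<open>\<rho> (inv g) * \<rho> h\<close> into \<open>\<rho> (inv g)\<close>, which carries
  \<open>h\<close> from the right of the average to its left.\<close>

lemma averaged_intertwines:
  assumes r: "complex_rep G n \<rho>" and s: "complex_rep G m \<sigma>" and i: "i < m" and j: "j < n"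
    and h: "h \<in> carrier G"
  shows "averaged m n \<sigma> \<rho> i j * \<rho> h = \<sigma> h * averaged m n \<sigma> \<rho> i j"
proof (rule eq_matI)
  note rD = complex_repD[OF r] and sD = complex_repD[OF s]
  let ?T = "averaged m n \<sigma> \<rho> i j"
  have T: "?T \<in> carrier_mat m n" by (simp add: averaged_def)
  fix k l assume "k < dim_row (\<sigma> h * ?T)" "l < dim_col (\<sigma> h * ?T)"
  then have k: "k < m" and l: "l < n" using sD(1)[OF h] T by auto
  have entry: "(A * B) $$ (a, b) = (\<Sum>c<q. A $$ (a, c) * B $$ (c, b))"
    if "A \<in> carrier_mat p q" "B \<in> carrier_mat q r" "a < p" "b < r" for A B :: "complex mat" and p q r a b
    using that by (auto simp: scalar_prod_def lessThan_atLeast0)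
  have "(?T * \<rho> h) $$ (k, l) = (\<Sum>c<n. (\<Sum>g\<in>carrier G. \<sigma> g $$ (k, i) * \<rho> (inv g) $$ (j, c)) * \<rho> h $$ (c, l))"
    using entry[OF T rD(1)[OF h] k l] k by (simp add: averaged_def)
  also have "\<dots> = (\<Sum>g\<in>carrier G. \<sigma> g $$ (k, i) * (\<Sum>c<n. \<rho> (inv g) $$ (j, c) * \<rho> h $$ (c, l)))"
    unfolding sum_distrib_right sum_distrib_left by (subst sum.swap) (simp add: mult.assoc)
  also have "\<dots> = (\<Sum>g\<in>carrier G. \<sigma> g $$ (k, i) * \<rho> (inv g \<otimes> h) $$ (j, l))"
    using entry[OF rD(1) rD(1)[OF h] j l] rD(2) h by (intro sum.cong) auto
  also have "\<dots> = (\<Sum>g\<in>carrier G. \<sigma> (h \<otimes> g) $$ (k, i) * \<rho> (inv (h \<otimes> g) \<otimes> h) $$ (j, l))"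
    by (rule sum_translate[OF h, symmetric])
  also have "\<dots> = (\<Sum>g\<in>carrier G. (\<Sum>c<m. \<sigma> h $$ (k, c) * \<sigma> g $$ (c, i)) * \<rho> (inv g) $$ (j, l))"
  proof (intro sum.cong refl arg_cong2[of _ _ _ _ "(*)"])
    fix g assume g: "g \<in> carrier G"
    show "\<sigma> (h \<otimes> g) $$ (k, i) = (\<Sum>c<m. \<sigma> h $$ (k, c) * \<sigma> g $$ (c, i))"
      using entry[OF sD(1)[OF h] sD(1)[OF g] k i] sD(2)[OF h g] by simp
    have "inv (h \<otimes> g) \<otimes> h = inv g"
      using g h by (simp add: inv_mult_group m_assoc)
    then show "\<rho> (inv (h \<otimes> g) \<otimes> h) $$ (j, l) = \<rho> (inv g) $$ (j, l)" by simp
  qed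
  also have "\<dots> = (\<Sum>c<m. \<sigma> h $$ (k, c) * (\<Sum>g\<in>carrier G. \<sigma> g $$ (c, i) * \<rho> (inv g) $$ (j, l)))"
    unfolding sum_distrib_right sum_distrib_left by (subst sum.swap) (simp add: mult.assoc)
  also have "\<dots> = (\<sigma> h * ?T) $$ (k, l)"
    using entry[OF sD(1)[OF h] T k l] l by (simp add: averaged_def)
  finally show "(?T * \<rho> h) $$ (k, l) = (\<sigma> h * ?T) $$ (k, l)" .
next
  show "dim_row (averaged m n \<sigma> \<rho> i j * \<rho> h) = dim_row (\<sigma> h * averaged m n \<sigma> \<rho> i j)"
    "dim_col (averaged m n \<sigma> \<rho> i j * \<rho> h) = dim_col (\<sigma> h * averaged m n \<sigma> \<rho> i j)"
    using complex_repD(1)[OF r h] complex_repD(1)[OF s h] by (auto simp: averaged_def)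
qed

text \<open>Multiplying out the two traces, the product of the diagonal entries \<open>i\<close> and
  \<open>j\<close> sums to one entry of an averaged matrix. Inner products of characters are thereby
  reduced to intertwiners, to which Schur's lemma applies.\<close>

lemma sum_trace_mult_trace:
  assumes r: "complex_rep G n \<rho>" and s: "complex_rep G m \<sigma>"
  shows "(\<Sum>g\<in>carrier G. mat_trace (\<sigma> g) * mat_trace (\<rho> (inv g))) =
    (\<Sum>i<m. \<Sum>j<n. averaged m n \<sigma> \<rho> i j $$ (i, j))"
proof -
  have "(\<Sum>g\<in>carrier G. mat_trace (\<sigma> g) * mat_trace (\<rho> (inv g))) =
     (\<Sum>g\<in>carrier G. \<Sum>i<m. \<Sum>j<n. \<sigma> g $$ (i, i) * \<rho> (inv g) $$ (j, j))"
    using carrier_matD(1)[OF complex_repD(1)[OF r]] carrier_matD(1)[OF complex_repD(1)[OF s]]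
    by (intro sum.cong) (auto simp: mat_trace_def sum_product)
  also have "\<dots> = (\<Sum>i<m. \<Sum>j<n. \<Sum>g\<in>carrier G. \<sigma> g $$ (i, i) * \<rho> (inv g) $$ (j, j))"
    by (subst sum.swap, intro sum.cong refl, rule sum.swap)
  also have "\<dots> = (\<Sum>i<m. \<Sum>j<n. averaged m n \<sigma> \<rho> i j $$ (i, j))"
    by (intro sum.cong refl) (simp add: averaged_def)
  finally show ?thesis .
qed

text \<open>A nonzero average would be an invertible intertwiner, which forces equal traces. The
  hypothesis compares characters and not representations because \<open>Irr G\<close> is a set of
  functions.\<close>

lemma orthogonality_distinct:
  assumes r: "irreducible_rep G n \<rho>" and s: "irreducible_rep G m \<sigma>"
    and ne: "rep_character G \<rho> \<noteq> rep_character G \<sigma>"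
  shows "(\<Sum>g\<in>carrier G. mat_trace (\<sigma> g) * mat_trace (\<rho> (inv g))) = 0"
proof -
  note r' = irreducible_repD(1)[OF r] and s' = irreducible_repD(1)[OF s]
  have zero: "averaged m n \<sigma> \<rho> i j = 0\<^sub>m m n" if ij: "i < m" "j < n" for i j
  proof (rule ccontr)
    let ?T = "averaged m n \<sigma> \<rho> i j"
    assume nz: "?T \<noteq> 0\<^sub>m m n"
    have T: "?T \<in> carrier_mat m n" by (simp add: averaged_def)
    note comm = averaged_intertwines[OF r' s' ij]
    obtain R where R: "R \<in> carrier_mat n m" "?T * R = 1\<^sub>m m" "R * ?T = 1\<^sub>m n"
      using schur_lemma[OF r s T nz comm] by blast
    have "mat_trace (\<rho> g) = mat_trace (\<sigma> g)" if g: "g \<in> carrier G" for g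
    proof -
      have "mat_trace (?T * \<rho> g * R) = mat_trace (\<rho> g)"
        by (rule mat_trace_conj[OF complex_repD(1)[OF r' g] T R(1) R(3)])
      moreover have "?T * \<rho> g * R = \<sigma> g"
        unfolding comm[OF g] using complex_repD(1)[OF s' g] T R
        by (metis assoc_mult_mat right_mult_one_mat)
      ultimately show ?thesis by simp
    qed
    then have "rep_character G \<rho> = rep_character G \<sigma>"
      by (auto simp: rep_character_def restrict_def)
    with ne show False by simp
  qed
  show ?thesis
    unfolding sum_trace_mult_trace[OF r' s'] using zero by simp
qed

text \<open>Each average is a scalar matrix, so its entry \<open>(i, j)\<close> vanishes off the
  diagonal. For \<open>i = j\<close> the scalar is found from the trace: swapping the two factors
  produces \<open>\<rho> (inv g) * \<rho> g = 1\<close> in each summand, so the trace is the group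
  order and each of the \<open>n\<close> diagonal terms is the order divided by
  \<open>n\<close>.\<close>

lemma orthogonality_same:
  assumes r: "irreducible_rep G n \<rho>"
  shows "(\<Sum>g\<in>carrier G. mat_trace (\<rho> g) * mat_trace (\<rho> (inv g))) = of_nat (order G)"
proof -
  note r' = irreducible_repD(1)[OF r]
  have n: "n > 0" by (rule irreducible_repD(2)[OF r])
  have entry: "averaged n n \<rho> \<rho> i j $$ (i, j) = (if i = j then of_nat (order G) / of_nat n else 0)"
    if ij: "i < n" "j < n" for i j
  proof -
    let ?T = "averaged n n \<rho> \<rho> i j"
    have T: "?T \<in> carrier_mat n n" by (simp add: averaged_def)
    obtain c where c: "?T = c \<cdot>\<^sub>m 1\<^sub>m n"
      using schur_lemma_scalar[OF r T averaged_intertwines[OF r' r' ij]] by blast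
    have "of_nat n * c = mat_trace ?T" using mat_trace_smult[OF one_carrier_mat, of c n] by (simp add: c)
    also have "\<dots> = (\<Sum>k<n. \<Sum>g\<in>carrier G. \<rho> g $$ (k, i) * \<rho> (inv g) $$ (j, k))"
      by (simp add: mat_trace_def averaged_def)
    also have "\<dots> = (\<Sum>g\<in>carrier G. \<Sum>k<n. \<rho> (inv g) $$ (j, k) * \<rho> g $$ (k, i))"
      by (subst sum.swap) (simp add: mult.commute)
    also have "\<dots> = (\<Sum>g\<in>carrier G. (1\<^sub>m n :: complex mat) $$ (j, i))"
    proof (intro sum.cong refl)
      fix g assume g: "g \<in> carrier G"
      have "(\<Sum>k<n. \<rho> (inv g) $$ (j, k) * \<rho> g $$ (k, i)) = (\<rho> (inv g) * \<rho> g) $$ (j, i)"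
        using complex_repD(1)[OF r' g] complex_repD(1)[OF r' inv_closed[OF g]] ij
        by (auto simp: scalar_prod_def lessThan_atLeast0)
      then show "(\<Sum>k<n. \<rho> (inv g) $$ (j, k) * \<rho> g $$ (k, i)) = (1\<^sub>m n :: complex mat) $$ (j, i)"
        using complex_rep_inv(2)[OF r' g] by simp
    qed
    also have "\<dots> = (if i = j then of_nat (order G) else 0)"
      using ij by (simp add: Coset.order_def)
    finally have "of_nat n * c = (if i = j then of_nat (order G) else 0)" .
    then show ?thesis using n ij by (auto simp: c field_simps)
  qed
  have "(\<Sum>i<n. \<Sum>j<n. averaged n n \<rho> \<rho> i j $$ (i, j)) =
      (\<Sum>i<n. \<Sum>j<n. if i = j then of_nat (order G) / of_nat n else (0::complex))"
    by (intro sum.cong refl) (simp add: entry)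
  also have "\<dots> = of_nat (order G)" using n by simp
  finally show ?thesis unfolding sum_trace_mult_trace[OF r' r'] .
qed

end

section \<open>Traces of powers via triangular matrices\<close>

lemma upper_triangular_mult:
  fixes A B :: "complex mat"
  assumes "A \<in> carrier_mat n n" "B \<in> carrier_mat n n" "upper_triangular A" "upper_triangular B"
  shows "upper_triangular (A * B)" and "i < n \<Longrightarrow> (A * B) $$ (i, i) = A $$ (i, i) * B $$ (i, i)"
proof -
  have entry: "(A * B) $$ (i, j) = (\<Sum>k<n. A $$ (i, k) * B $$ (k, j))" if "i < n" "j < n" for i j
    using assms that by (auto simp: scalar_prod_def lessThan_atLeast0)
  \<comment> \<open>A nonzero term requires \<open>i \<le> k \<le> j\<close>; together with
    \<open>j \<le> i\<close> this leaves only \<open>k = i = j\<close>.\<close>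
  have z: "A $$ (i, k) * B $$ (k, j) = 0" if "i < n" "k < n" "j \<le> i" "k \<noteq> i \<or> j \<noteq> i" for i j k
  proof (cases "k < i")
    case True
    then show ?thesis using assms that by (simp add: upper_triangularD)
  next
    case False
    then have "j < k" using that by auto
    then show ?thesis using assms that by (simp add: upper_triangularD)
  qed
  show "upper_triangular (A * B)"
  proof (rule upper_triangularI)
    fix i j assume "j < i" "i < dim_row (A * B)"
    then have "i < n" "j < n" "j < i" using assms(1) by auto
    then show "(A * B) $$ (i, j) = 0" using entry z by (simp only: entry) (intro sum.neutral, auto)
  qed
  assume i: "i < n"
  have "(\<Sum>k<n. A $$ (i, k) * B $$ (k, i)) = (\<Sum>k<n. if k = i then A $$ (i, i) * B $$ (i, i) else 0)"
    using z i by (intro sum.cong) auto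
  then show "(A * B) $$ (i, i) = A $$ (i, i) * B $$ (i, i)"
    using entry i by simp
qed

lemma upper_triangular_pow:
  fixes A :: "complex mat"
  assumes "A \<in> carrier_mat n n" "upper_triangular A"
  shows "upper_triangular (A ^\<^sub>m k) \<and> (\<forall>i<n. (A ^\<^sub>m k) $$ (i, i) = A $$ (i, i) ^ k)"
proof (induction k)
  case 0
  then show ?case using assms by auto
next
  case (Suc k)
  have "A ^\<^sub>m k \<in> carrier_mat n n" using assms by simp
  from upper_triangular_mult[OF this assms(1) _ assms(2)] Suc show ?case by simp
qed

text \<open>The numbers are the diagonal entries of a Schur triangular form of \<open>A\<close>,
  whose powers are triangular with the powers of these entries on the diagonal. It matters that one
  family serves all exponents \<open>k\<close>: values of a character at \<open>g\<close> and at
  powers of \<open>g\<close> are compared through it.\<close>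

lemma trace_pow_eigenvalues:
  fixes A :: "complex mat"
  assumes A: "A \<in> carrier_mat n n" and N: "A ^\<^sub>m N = 1\<^sub>m n"
  shows "\<exists>\<epsilon>. (\<forall>i<n. \<epsilon> i ^ N = 1) \<and> (\<forall>k. mat_trace (A ^\<^sub>m k) = (\<Sum>i<n. \<epsilon> i ^ k))"
proof -
  obtain es where "char_poly A = (\<Prod>e\<leftarrow>es. [:- e, 1:])"
    using char_poly_factorized[OF A] by blast
  then obtain B where B: "B \<in> carrier_mat n n" "upper_triangular B" "similar_mat A B"
    using schur_decomposition_exists[OF A] by blast
  obtain P Q where w: "similar_mat_wit A B P Q" using B(3) by (auto simp: similar_mat_def)
  note wD = similar_mat_witD2[OF A w]
  have pow: "A ^\<^sub>m k = P * B ^\<^sub>m k * Q" for k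
    using similar_mat_wit_pow_id[OF w] by blast
  have "B ^\<^sub>m N = Q * (P * B ^\<^sub>m N * Q) * P"
    using wD B(1) pow_carrier_mat[OF B(1), of N]
    by (smt (verit) assoc_mult_mat left_mult_one_mat mult_carrier_mat right_mult_one_mat)
  also have "\<dots> = 1\<^sub>m n" unfolding pow[symmetric] N using wD by simp
  finally have BN: "B ^\<^sub>m N = 1\<^sub>m n" .
  show ?thesis
  proof (intro exI[of _ "\<lambda>i. B $$ (i, i)"] conjI allI impI)
    fix i assume "i < n"
    then show "B $$ (i, i) ^ N = 1"
      using upper_triangular_pow[OF B(1,2), of N] BN by simp
  next
    fix k
    have "mat_trace (A ^\<^sub>m k) = mat_trace (B ^\<^sub>m k)"
      unfolding pow using wD B(1) by (intro mat_trace_conj) auto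
    then show "mat_trace (A ^\<^sub>m k) = (\<Sum>i<n. B $$ (i, i) ^ k)"
      using upper_triangular_pow[OF B(1,2), of k] B(1) by (simp add: mat_trace_def)
  qed
qed

section \<open>Burnside's theorem on zeros of characters\<close>

definition unity_root :: "nat \<Rightarrow> complex" where
  "unity_root N = cis (2 * pi / real N)"

lemma unity_root_power: "unity_root N ^ k = cis (2 * pi * real k / real N)"
  by (simp add: unity_root_def DeMoivre field_simps)

lemma unity_root_power_order [simp]: "N > 0 \<Longrightarrow> unity_root N ^ N = 1"
  by (simp add: unity_root_power)

lemma root_of_unity_eq_power:
  assumes "N > 0" "z ^ N = 1"
  shows "\<exists>k. z = unity_root N ^ k"
proof -
  have "z \<in> (\<lambda>k. cis (2 * pi * real k / real N)) ` {..<N}"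
    using bij_betw_roots_unity[OF assms(1)] assms(2) unfolding bij_betw_def by blast
  then show ?thesis by (auto simp: unity_root_power)
qed

section \<open>Integrality of sums over primitive roots of unity\<close>

lemma sum_powers_root_of_unity:
  fixes z :: complex
  assumes "z ^ N = 1"
  shows "(\<Sum>j\<in>{0<..N}. z ^ j) \<in> \<int>"
proof (cases "z = 1")
  case True
  then show ?thesis by simp
next
  case False
  have "(\<Sum>j\<in>{0<..N}. z ^ j) = (\<Sum>j<N. z ^ Suc j)"
    by (rule sum.reindex_bij_witness[of _ Suc "\<lambda>j. j - 1"]) auto
  also have "\<dots> = z * (\<Sum>j<N. z ^ j)" by (simp add: sum_distrib_left)
  also have "\<dots> = 0" using False assms by (simp add: geometric_sum)
  finally show ?thesis by simp
qed

text \<open>Sort the full sum over \<open>0 < j \<le> N\<close>, an integer by the geometric series,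
  by the value \<open>d\<close> of \<open>gcd j N\<close>. The block of \<open>d\<close> is the same
  kind of sum for \<open>N div d\<close>, an integer by induction unless \<open>d = 1\<close>; what
  is left is the block of the totatives.\<close>

lemma ramanujan_sum_integer:
  assumes "N > 0"
  shows "(\<Sum>j\<in>totatives N. unity_root N ^ (j * k)) \<in> \<int>"
  using assms
proof (induction N rule: less_induct)
  case (less N)
  let ?S = "\<lambda>d. {j \<in> {0<..N}. gcd j N = d}"
  let ?f = "\<lambda>j. unity_root N ^ (j * k)"
  have part: "sum ?f (?S d) = (\<Sum>j\<in>totatives (N div d). unity_root (N div d) ^ (j * k))" if d: "d dvd N" for d
  proof -
    have d0: "d > 0" "N div d > 0" using d less.prems by (auto elim: dvdE intro: Nat.gr0I)
    have "sum ?f (?S d) = (\<Sum>j\<in>totatives (N div d). ?f (j * d))"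
      by (rule sum.reindex_bij_betw[symmetric]) (use bij_betw_totatives_gcd_eq d less.prems in auto)
    also have "\<dots> = (\<Sum>j\<in>totatives (N div d). unity_root (N div d) ^ (j * k))"
    proof (rule sum.cong[OF refl])
      fix j
      \<comment> \<open>The \<open>d\<close>-th power of the standard \<open>N\<close>-th root of
        unity is the standard root of order \<open>N div d\<close>.\<close>
      have "real N = real (N div d) * real d" using d by (metis dvd_div_mult_self of_nat_mult)
      then show "?f (j * d) = unity_root (N div d) ^ (j * k)"
        using d0 less.prems by (simp add: unity_root_power field_simps)
    qed
    finally show ?thesis .
  qed
  have "sum ?f {0<..N} = (\<Sum>j\<in>{0<..N}. (unity_root N ^ k) ^ j)"
    by (simp add: power_mult[symmetric] mult.commute)
  also have "\<dots> \<in> \<int>"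
    using less.prems by (intro sum_powers_root_of_unity) (simp add: power_mult[symmetric] mult.commute[of k], simp add: power_mult)
  finally have total: "sum ?f {0<..N} \<in> \<int>" .
  have "sum ?f {0<..N} = (\<Sum>d\<in>{d. d dvd N}. sum ?f (?S d))"
    using less.prems by (intro sum.group[symmetric]) auto
  also have "\<dots> = sum ?f (?S 1) + (\<Sum>d\<in>{d. d dvd N} - {1}. sum ?f (?S d))"
    using less.prems by (intro sum.remove) auto
  finally have "sum ?f (?S 1) = sum ?f {0<..N} - (\<Sum>d\<in>{d. d dvd N} - {1}. sum ?f (?S d))" by simp
  moreover have "(\<Sum>d\<in>{d. d dvd N} - {1}. sum ?f (?S d)) \<in> \<int>"
  proof (rule Ints_sum)
    fix d assume "d \<in> {d. d dvd N} - {1}"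
    then have d: "d dvd N" "d \<noteq> 1" by auto
    then have "N div d < N" "N div d > 0" using less.prems
      by (auto elim!: dvdE intro: Nat.gr0I)
    then show "sum ?f (?S d) \<in> \<int>" unfolding part[OF d(1)] by (rule less.IH)
  qed
  ultimately have "sum ?f (?S 1) \<in> \<int>" using total by simp
  then show ?case using part[of 1] by simp
qed

text \<open>This is the trace to the rationals of an element of the ring generated by a root of
  unity, expanded through the coefficients of \<open>p\<close> into an integer combination of
  Ramanujan sums.\<close>

lemma sum_poly_totatives_integer:
  assumes "N > 0"
  shows "(\<Sum>j\<in>totatives N. poly (of_int_poly p) (unity_root N ^ j)) \<in> \<int>"
proof -
  have "(\<Sum>j\<in>totatives N. poly (of_int_poly p) (unity_root N ^ j)) =
      (\<Sum>i\<le>degree p. of_int (Polynomial.coeff p i) * (\<Sum>j\<in>totatives N. unity_root N ^ (j * i)))"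
    unfolding sum_distrib_left
    by (subst sum.swap) (simp add: poly_altdef power_mult)
  then show ?thesis
    using assms by (auto intro!: Ints_sum Ints_mult ramanujan_sum_integer)
qed

text \<open>A number all of whose conjugates coincide: since \<open>totient N * z ^ k\<close> is an integer for every
  \<open>k\<close>, it cannot be arbitrarily small.\<close>

lemma norm_ge_1_if_conjugates_equal:
  assumes N: "N > 0" and z: "z \<noteq> 0"
    and p: "\<And>j. j \<in> totatives N \<Longrightarrow> poly (of_int_poly p) (unity_root N ^ j) = z"
  shows "norm z \<ge> 1"
proof (rule ccontr)
  assume "\<not> ?thesis"
  then have z1: "norm z < 1" by simp
  have t: "totient N > 0" using N by simp
  have int: "of_nat (totient N) * z ^ k \<in> \<int>" for k
  proof -
    have "(\<Sum>j\<in>totatives N. poly (of_int_poly (p ^ k)) (unity_root N ^ j)) = (\<Sum>j\<in>totatives N. z ^ k)"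
      using p by (intro sum.cong) (auto simp: of_int_poly_hom.hom_power)
    also have "\<dots> = of_nat (totient N) * z ^ k" by (simp add: totient_def)
    finally show ?thesis using sum_poly_totatives_integer[OF N, of "p ^ k"] by simp
  qed
  obtain k where k: "norm z ^ k < 1 / real (totient N)"
    using real_arch_pow_inv[of "1 / real (totient N)" "norm z"] t z1 by auto
  have "norm (of_nat (totient N) * z ^ k) < 1"
    using k t by (simp add: norm_mult norm_power field_simps)
  moreover obtain a :: int where a: "of_nat (totient N) * z ^ k = of_int a"
    using int[of k] by (auto elim: Ints_cases)
  ultimately have "\<bar>real_of_int a\<bar> < 1" by simp
  then have "a = 0" by linarith
  with a t z show False by simp
qed

context group
begin

text \<open>The eigenvalues of \<open>\<rho> g\<close> are powers of one root of unity, and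
  \<open>p\<close> is the sum of the corresponding monomials. Replacing the root by its
  \<open>j\<close>-th power then has the same effect as replacing \<open>g\<close> by its
  \<open>j\<close>-th power.\<close>

lemma rep_trace_pow_poly:
  assumes r: "complex_rep G n \<rho>" and g: "g \<in> carrier G" and N: "N > 0" "g [^] N = \<one>"
  shows "\<exists>p. \<forall>j. mat_trace (\<rho> (g [^] (j::nat))) = poly (of_int_poly p) (unity_root N ^ j)"
proof -
  have "\<rho> g ^\<^sub>m N = 1\<^sub>m n"
    using complex_rep_pow[OF r g, of N] N complex_repD(3)[OF r] by simp
  then obtain \<epsilon> where e: "\<forall>i<n. \<epsilon> i ^ N = 1" "\<forall>k. mat_trace (\<rho> g ^\<^sub>m k) = (\<Sum>i<n. \<epsilon> i ^ k)"
    using trace_pow_eigenvalues[OF complex_repD(1)[OF r g]] by blast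
  have "\<forall>i. \<exists>k. i < n \<longrightarrow> \<epsilon> i = unity_root N ^ k"
    using e(1) root_of_unity_eq_power[OF N(1)] by blast
  then obtain k where k: "\<And>i. i < n \<Longrightarrow> \<epsilon> i = unity_root N ^ k i" by metis
  show ?thesis
  proof (intro exI[of _ "\<Sum>i<n. Polynomial.monom 1 (k i)"] allI)
    fix j
    have "poly (of_int_poly (\<Sum>i<n. Polynomial.monom 1 (k i))) (unity_root N ^ j) = (\<Sum>i<n. (unity_root N ^ j) ^ k i)"
      by (simp add: of_int_poly_hom.hom_sum poly_sum poly_monom)
    also have "\<dots> = (\<Sum>i<n. \<epsilon> i ^ j)"
      using k by (intro sum.cong) (auto simp: power_mult[symmetric] mult.commute)
    finally show "mat_trace (\<rho> (g [^] j)) = poly (of_int_poly (\<Sum>i<n. Polynomial.monom 1 (k i))) (unity_root N ^ j)"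
      using e(2) complex_rep_pow[OF r g] by simp
  qed
qed

end

context finite_group
begin

lemma pow_order [simp]: "g \<in> carrier G \<Longrightarrow> g [^] order G = \<one>"
  by (rule pow_order_eq_1)

text \<open>The inverse of \<open>g\<close> is its power with exponent \<open>order G - 1\<close>.
  On eigenvalues, which have norm 1, this power is complex conjugation.\<close>

lemma rep_trace_inv:
  assumes r: "complex_rep G n \<rho>" and g: "g \<in> carrier G"
  shows "mat_trace (\<rho> (inv g)) = cnj (mat_trace (\<rho> g))"
proof -
  let ?N = "order G"
  have "\<rho> g ^\<^sub>m ?N = 1\<^sub>m n"
    using complex_rep_pow[OF r g, of ?N] g complex_repD(3)[OF r] by simp
  then obtain \<epsilon> where e: "\<forall>i<n. \<epsilon> i ^ ?N = 1" "\<forall>k. mat_trace (\<rho> g ^\<^sub>m k) = (\<Sum>i<n. \<epsilon> i ^ k)"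
    using trace_pow_eigenvalues[OF complex_repD(1)[OF r g]] by blast
  have "g [^] (?N - 1) \<otimes> g = \<one>"
    using g order_pos pow_order[OF g] by (metis Suc_diff_1 nat_pow_Suc)
  then have inv: "inv g = g [^] (?N - 1)"
    using g by (intro inv_equality) auto
  have "\<epsilon> i ^ (?N - 1) = cnj (\<epsilon> i)" if "i < n" for i
  proof -
    have 1: "\<epsilon> i ^ ?N = 1" using e(1) that by blast
    then have "norm (\<epsilon> i) ^ ?N = 1" by (metis norm_one norm_power)
    then have nrm: "norm (\<epsilon> i) = 1" using power_eq_imp_eq_base[of "norm (\<epsilon> i)" ?N 1] order_pos by simp
    then have c: "\<epsilon> i * cnj (\<epsilon> i) = 1" by (simp add: complex_norm_square[symmetric])
    have "\<epsilon> i ^ (?N - 1) * \<epsilon> i = 1" using 1 order_pos by (metis Suc_diff_1 power_Suc2)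
    then have "\<epsilon> i ^ (?N - 1) * (\<epsilon> i * cnj (\<epsilon> i)) = cnj (\<epsilon> i)"
      by (simp only: mult.assoc[symmetric] mult_1_left)
    then show ?thesis using c by simp
  qed
  then have "(\<Sum>i<n. \<epsilon> i ^ (?N - 1)) = cnj (\<Sum>i<n. \<epsilon> i)" by simp
  moreover have "mat_trace (\<rho> (inv g)) = (\<Sum>i<n. \<epsilon> i ^ (?N - 1))"
    unfolding inv complex_rep_pow[OF r g] using e(2) by blast
  moreover have "mat_trace (\<rho> g) = (\<Sum>i<n. \<epsilon> i)"
    using e(2)[rule_format, of 1] complex_repD(1)[OF r g] by simp
  ultimately show ?thesis by simp
qed

text \<open>Exponents count only modulo the group order, so the power map with exponent an inverse
  of \<open>j\<close> modulo the order undoes this one.\<close>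

lemma bij_betw_coprime_pow:
  assumes j: "coprime j (order G)"
  shows "bij_betw (\<lambda>g. g [^] j) (carrier G - {\<one>}) (carrier G - {\<one>})"
proof -
  let ?N = "order G"
  obtain a where a: "[j * a = 1] (mod ?N)" using cong_solve_coprime_nat[OF j] by auto
  have red: "g [^] m = g [^] (m mod ?N)" if "g \<in> carrier G" for g and m :: nat
  proof -
    have "g [^] m = g [^] (?N * (m div ?N) + m mod ?N)" by simp
    also have "\<dots> = (g [^] ?N) [^] (m div ?N) \<otimes> g [^] (m mod ?N)"
      using that by (simp only: nat_pow_mult[symmetric] nat_pow_pow)
    finally show ?thesis using that by simp
  qed
  have id: "g [^] (j * a) = g" if g: "g \<in> carrier G" for g
  proof -
    have "g [^] (j * a) = g [^] (1::nat)"
      using red[OF g, of "j * a"] red[OF g, of 1] a by (simp add: cong_def)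
    then show ?thesis using g by simp
  qed
  have 1: "(g [^] j) [^] a = g" "(g [^] a) [^] j = g" if "g \<in> carrier G" for g
    using id[OF that] that by (simp_all add: nat_pow_pow mult.commute)
  show ?thesis
  proof (rule bij_betw_byWitness[where f' = "\<lambda>g. g [^] a"])
    have "g [^] j \<noteq> \<one>" "g [^] a \<noteq> \<one>" if "g \<in> carrier G" "g \<noteq> \<one>" for g
      using 1[OF that(1)] that(2) by (metis nat_pow_one)+
    then show "(\<lambda>g. g [^] j) ` (carrier G - {\<one>}) \<subseteq> carrier G - {\<one>}"
      "(\<lambda>g. g [^] a) ` (carrier G - {\<one>}) \<subseteq> carrier G - {\<one>}" by auto
  qed (use 1 in auto)
qed

lemma sum_norm_squared_character:
  assumes r: "irreducible_rep G n \<rho>"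
  shows "(\<Sum>g\<in>carrier G. (norm (mat_trace (\<rho> g)))\<^sup>2) = real (order G)"
proof -
  have "complex_of_real (\<Sum>g\<in>carrier G. (norm (mat_trace (\<rho> g)))\<^sup>2) =
      (\<Sum>g\<in>carrier G. mat_trace (\<rho> g) * mat_trace (\<rho> (inv g)))"
    using rep_trace_inv[OF irreducible_repD(1)[OF r]]
    by (simp add: complex_norm_square del: of_real_power)
  also have "\<dots> = of_nat (order G)" by (rule orthogonality_same[OF r])
  finally show ?thesis by (metis of_real_eq_iff of_real_of_nat_eq)
qed

text \<open>Burnside: the product of the nonzero values away from the identity has norm at least 1, so
  by \<open>ln x \<le> x - 1\<close> the mean of the squared norms there is at least 1.\<close>

theorem burnside_zero:
  assumes r: "irreducible_rep G n \<rho>" and n: "n > 1"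
  shows "\<exists>g\<in>carrier G. mat_trace (\<rho> g) = 0"
proof (rule ccontr)
  assume "\<not> ?thesis"
  then have nz: "mat_trace (\<rho> g) \<noteq> 0" if "g \<in> carrier G" for g using that by blast
  note r' = irreducible_repD(1)[OF r]
  let ?N = "order G" and ?D = "carrier G - {\<one>}"
  define P where "P = (\<Prod>g\<in>?D. mat_trace (\<rho> g))"
  have fin: "finite ?D" using finite_carrier by simp
  have P0: "P \<noteq> 0" using nz fin by (simp add: P_def)
  have "\<forall>g. \<exists>p. g \<in> carrier G \<longrightarrow>
      (\<forall>j::nat. mat_trace (\<rho> (g [^] j)) = poly (of_int_poly p) (unity_root ?N ^ j))"
    using rep_trace_pow_poly[OF r' _ order_pos] by (metis pow_order)
  then obtain p where p: "\<And>g j. g \<in> carrier G \<Longrightarrow>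
      mat_trace (\<rho> (g [^] (j::nat))) = poly (of_int_poly (p g)) (unity_root ?N ^ j)" by metis
  have "norm P \<ge> 1"
  proof (rule norm_ge_1_if_conjugates_equal[OF order_pos P0])
    fix j assume "j \<in> totatives ?N"
    then have j: "coprime j ?N" by (simp add: in_totatives_iff)
    \<comment> \<open>Conjugation merely permutes the factors of \<open>P\<close>, since it is a
      power map on the nonidentity elements.\<close>
    have "poly (of_int_poly (\<Prod>g\<in>?D. p g)) (unity_root ?N ^ j) = (\<Prod>g\<in>?D. mat_trace (\<rho> (g [^] j)))"
      using p by (simp add: of_int_poly_hom.hom_prod poly_prod)
    also have "\<dots> = P" unfolding P_def by (rule prod.reindex_bij_betw[OF bij_betw_coprime_pow[OF j]])
    finally show "poly (of_int_poly (\<Prod>g\<in>?D. p g)) (unity_root ?N ^ j) = P" .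
  qed
  then have "0 \<le> ln ((norm P)\<^sup>2)" by simp
  also have "(norm P)\<^sup>2 = (\<Prod>g\<in>?D. (norm (mat_trace (\<rho> g)))\<^sup>2)"
    by (simp add: P_def prod_norm[symmetric] prod_power_distrib)
  also have "ln \<dots> = (\<Sum>g\<in>?D. ln ((norm (mat_trace (\<rho> g)))\<^sup>2))"
    using nz fin by (intro ln_prod) auto
  also have "\<dots> \<le> (\<Sum>g\<in>?D. (norm (mat_trace (\<rho> g)))\<^sup>2 - 1)"
    using nz by (intro sum_mono ln_le_minus_one) auto
  also have "\<dots> = (\<Sum>g\<in>?D. (norm (mat_trace (\<rho> g)))\<^sup>2) - real (card ?D)"
    by (simp add: sum_subtractf)
  \<comment> \<open>The identity takes \<open>n\<^sup>2\<close> out of the total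
    \<open>order G\<close>. The chain then reads
    \<open>0 \<le> (order G - n\<^sup>2) - (order G - 1)\<close>, which forces
    \<open>n \<le> 1\<close>.\<close>
  also have "(\<Sum>g\<in>?D. (norm (mat_trace (\<rho> g)))\<^sup>2) = real ?N - (real n)\<^sup>2"
    using sum_norm_squared_character[OF r] sum.remove[OF finite_carrier one_closed, of "\<lambda>g. (norm (mat_trace (\<rho> g)))\<^sup>2"]
      complex_repD(3)[OF r'] by simp
  also have "real (card ?D) = real ?N - 1"
    using order_pos finite_carrier by (simp add: Coset.order_def of_nat_diff)
  finally have "(real n)\<^sup>2 \<le> 1" by simp
  then show False using n by (simp add: power_le_one_iff)
qed

end

section \<open>Linear characters and zero classes\<close>

lemma mat_trace_unit_carrier: "A \<in> carrier_mat (Suc 0) (Suc 0) \<Longrightarrow> mat_trace A = A $$ (0, 0)"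
  by (auto simp: mat_trace_def)

section \<open>Bessel's inequality and finiteness of the set of irreducible characters\<close>

context finite_group
begin

text \<open>Expand the squared distance from \<open>order G\<close> times \<open>v\<close> to
  \<open>s\<close>. The characters have squared length \<open>order G\<close> instead of 1, and
  scaling \<open>v\<close> clears that denominator. A general finite family \<open>F\<close> is
  allowed so that the inequality can itself yield finiteness of \<open>Irr G\<close>.\<close>

lemma bessel_inequality:
  fixes v :: "'a \<Rightarrow> complex"
  assumes F: "finite F"
    and orth: "\<And>\<phi> \<psi>. \<phi> \<in> F \<Longrightarrow> \<psi> \<in> F \<Longrightarrow>
      (\<Sum>g\<in>carrier G. \<phi> g * cnj (\<psi> g)) = (if \<phi> = \<psi> then of_nat (order G) else 0)"
  shows "(\<Sum>\<phi>\<in>F. (norm (\<Sum>g\<in>carrier G. v g * cnj (\<phi> g)))\<^sup>2) \<le>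
    real (order G) * (\<Sum>g\<in>carrier G. (norm (v g))\<^sup>2)"
proof -
  let ?N = "of_nat (order G) :: complex"
  define c where "c \<phi> = (\<Sum>g\<in>carrier G. v g * cnj (\<phi> g))" for \<phi>
  define s where "s g = (\<Sum>\<phi>\<in>F. c \<phi> * \<phi> g)" for g
  define C where "C = (\<Sum>\<phi>\<in>F. (norm (c \<phi>))\<^sup>2)"
  define V where "V = (\<Sum>g\<in>carrier G. (norm (v g))\<^sup>2)"
  have C: "complex_of_real C = (\<Sum>\<phi>\<in>F. c \<phi> * cnj (c \<phi>))"
    by (simp add: C_def complex_norm_square del: of_real_power)
  have vs: "(\<Sum>g\<in>carrier G. v g * cnj (s g)) = of_real C"
  proof -
    have "(\<Sum>g\<in>carrier G. v g * cnj (s g)) = (\<Sum>\<phi>\<in>F. \<Sum>g\<in>carrier G. cnj (c \<phi>) * (v g * cnj (\<phi> g)))"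
      by (subst sum.swap) (simp add: s_def sum_distrib_left mult_ac)
    also have "\<dots> = (\<Sum>\<phi>\<in>F. c \<phi> * cnj (c \<phi>))"
      unfolding sum_distrib_left[symmetric] c_def[symmetric] by (simp add: mult.commute)
    finally show ?thesis by (simp add: C)
  qed
  have sv: "(\<Sum>g\<in>carrier G. s g * cnj (v g)) = of_real C"
    using arg_cong[OF vs, of cnj] by (simp add: mult.commute)
  have ss: "(\<Sum>g\<in>carrier G. s g * cnj (s g)) = ?N * of_real C"
  proof -
    have "(\<Sum>g\<in>carrier G. s g * cnj (s g)) =
        (\<Sum>g\<in>carrier G. \<Sum>\<phi>\<in>F. \<Sum>\<psi>\<in>F. c \<phi> * cnj (c \<psi>) * (\<phi> g * cnj (\<psi> g)))"
      by (simp add: s_def sum_product mult_ac)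
    also have "\<dots> = (\<Sum>\<phi>\<in>F. \<Sum>\<psi>\<in>F. c \<phi> * cnj (c \<psi>) * (\<Sum>g\<in>carrier G. \<phi> g * cnj (\<psi> g)))"
      unfolding sum_distrib_left by (subst sum.swap, intro sum.cong refl, rule sum.swap)
    also have "\<dots> = (\<Sum>\<phi>\<in>F. \<Sum>\<psi>\<in>F. if \<phi> = \<psi> then ?N * (c \<phi> * cnj (c \<phi>)) else 0)"
      using orth by (intro sum.cong) auto
    also have "\<dots> = ?N * of_real C" using F by (simp add: C sum_distrib_left)
    finally show ?thesis .
  qed
  have "complex_of_real (\<Sum>g\<in>carrier G. (norm (?N * v g - s g))\<^sup>2) =
      (\<Sum>g\<in>carrier G. ?N * ?N * (v g * cnj (v g)) - ?N * (v g * cnj (s g)) - ?N * (s g * cnj (v g)) + s g * cnj (s g))"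
    by (simp add: complex_norm_square algebra_simps del: of_real_power)
  also have "\<dots> = ?N * ?N * (\<Sum>g\<in>carrier G. v g * cnj (v g)) - ?N * of_real C - ?N * of_real C + ?N * of_real C"
    by (simp only: sum.distrib sum_subtractf sum_distrib_left[symmetric] vs sv ss)
  also have "(\<Sum>g\<in>carrier G. v g * cnj (v g)) = of_real V"
    by (simp add: V_def complex_norm_square del: of_real_power)
  also have "?N * ?N * of_real V - ?N * of_real C - ?N * of_real C + ?N * of_real C =
      of_real (real (order G) * (real (order G) * V - C))"
    by (simp add: algebra_simps)
  finally have "(\<Sum>g\<in>carrier G. (norm (?N * v g - s g))\<^sup>2) = real (order G) * (real (order G) * V - C)"
    by (simp only: of_real_eq_iff)
  moreover have "(\<Sum>g\<in>carrier G. (norm (?N * v g - s g))\<^sup>2) \<ge> 0" by (intro sum_nonneg) auto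
  ultimately have "C \<le> real (order G) * V"
    using order_pos by (simp add: zero_le_mult_iff)
  then show ?thesis by (simp add: C_def V_def c_def)
qed

lemma IrrE:
  assumes "\<chi> \<in> Irr G"
  obtains n \<rho> where "irreducible_rep G n \<rho>" "complex_rep G n \<rho>" "n > 0" "\<chi> = rep_character G \<rho>"
    "\<And>g. g \<in> carrier G \<Longrightarrow> \<chi> g = mat_trace (\<rho> g)" "\<chi> \<one> = of_nat n"
proof -
  obtain n \<rho> where r: "irreducible_rep G n \<rho>" and c: "\<chi> = rep_character G \<rho>"
    using assms by (auto simp: Irr_def)
  show thesis
    by (rule that[OF r irreducible_repD(1,2)[OF r] c])
      (simp_all add: c rep_character_def complex_repD(3)[OF irreducible_repD(1)[OF r]])
qed

lemma Irr_degree: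
  assumes "\<chi> \<in> Irr G"
  obtains n where "n > 0" "\<chi> \<one> = of_nat n"
  by (rule IrrE[OF assms]) (rule that)

lemma rep_character_in_Irr: "irreducible_rep G n \<rho> \<Longrightarrow> rep_character G \<rho> \<in> Irr G"
  by (auto simp: Irr_def)

lemma Irr_orthogonality:
  assumes "\<phi> \<in> Irr G" "\<psi> \<in> Irr G"
  shows "(\<Sum>g\<in>carrier G. \<phi> g * cnj (\<psi> g)) = (if \<phi> = \<psi> then of_nat (order G) else 0)"
proof -
  obtain m \<sigma> where s: "irreducible_rep G m \<sigma>" "\<phi> = rep_character G \<sigma>"
      "\<And>g. g \<in> carrier G \<Longrightarrow> \<phi> g = mat_trace (\<sigma> g)" using IrrE[OF assms(1)] by metis
  obtain n \<rho> where r: "irreducible_rep G n \<rho>" "\<psi> = rep_character G \<rho>"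
      "\<And>g. g \<in> carrier G \<Longrightarrow> \<psi> g = mat_trace (\<rho> g)" using IrrE[OF assms(2)] by metis
  have "(\<Sum>g\<in>carrier G. \<phi> g * cnj (\<psi> g)) = (\<Sum>g\<in>carrier G. \<phi> g * mat_trace (\<rho> (inv g)))"
    using rep_trace_inv[OF irreducible_repD(1)[OF r(1)]] r(3) by (intro sum.cong) auto
  also have "\<dots> = (if \<phi> = \<psi> then of_nat (order G) else 0)"
  proof (cases "\<phi> = \<psi>")
    case True
    then show ?thesis using orthogonality_same[OF r(1)] r(3) by simp
  next
    case False
    then show ?thesis using orthogonality_distinct[OF r(1) s(1)] s r(2) by simp
  qed
  finally show ?thesis .
qed

text \<open>Against the indicator of the identity every irreducible character has its degree as
  coefficient, which is at least 1, so Bessel's inequality bounds every finite subset by the group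
  order. Finiteness has to be settled before any counting, since \<open>card\<close> is 0 on
  infinite sets.\<close>

lemma finite_Irr: "finite (Irr G)"
proof -
  have "card F \<le> order G" if F: "F \<subseteq> Irr G" "finite F" for F
  proof -
    let ?v = "\<lambda>g. if g = \<one> then 1 else 0 :: complex"
    have "real (card F) \<le> (\<Sum>\<phi>\<in>F. (norm (\<Sum>g\<in>carrier G. ?v g * cnj (\<phi> g)))\<^sup>2)"
    proof -
      have "1 \<le> (norm (\<Sum>g\<in>carrier G. ?v g * cnj (\<phi> g)))\<^sup>2" if "\<phi> \<in> F" for \<phi>
      proof -
        have "\<phi> \<in> Irr G" using F(1) that by blast
        then obtain n where n: "n > 0" "\<phi> \<one> = of_nat n" by (rule Irr_degree)
        have "(\<Sum>g\<in>carrier G. ?v g * cnj (\<phi> g)) = (\<Sum>g\<in>carrier G. if g = \<one> then cnj (\<phi> g) else 0)"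
          by (intro sum.cong) auto
        also have "\<dots> = of_nat n" using finite_carrier n by simp
        finally have "norm (\<Sum>g\<in>carrier G. ?v g * cnj (\<phi> g)) = real n" by simp
        then show ?thesis using n(1) by (simp add: one_le_power)
      qed
      then show ?thesis using sum_mono[of F "\<lambda>_. 1 :: real"] by simp
    qed
    also have "\<dots> \<le> real (order G) * (\<Sum>g\<in>carrier G. (norm (?v g))\<^sup>2)"
      using F by (intro bessel_inequality Irr_orthogonality) auto
    also have "(\<Sum>g\<in>carrier G. (norm (?v g))\<^sup>2) = (\<Sum>g\<in>carrier G. if g = \<one> then 1 else 0)"
      by (intro sum.cong) auto
    also have "\<dots> = 1" using finite_carrier by simp
    finally show ?thesis by simp
  qed
  then show ?thesis using finite_if_finite_subsets_card_bdd[of "Irr G" "order G"] by blast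
qed

lemma Irr_class_function:
  assumes "\<chi> \<in> Irr G" "g \<in> carrier G" "h \<in> carrier G"
  shows "\<chi> (h \<otimes> g \<otimes> inv h) = \<chi> g"
proof -
  obtain n \<rho> where r: "complex_rep G n \<rho>" "\<And>g. g \<in> carrier G \<Longrightarrow> \<chi> g = mat_trace (\<rho> g)"
    using IrrE[OF assms(1)] by metis
  note rD = complex_repD[OF r(1)]
  have "\<rho> (h \<otimes> g \<otimes> inv h) = \<rho> h * \<rho> g * \<rho> (inv h)" using rD(2) assms by simp
  moreover have "mat_trace (\<rho> h * \<rho> g * \<rho> (inv h)) = mat_trace (\<rho> g)"
    using assms(2,3) by (intro mat_trace_conj[OF rD(1) rD(1) rD(1) complex_rep_inv(2)[OF r(1)]]) auto
  ultimately show ?thesis using r(2) assms by simp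
qed

section \<open>Linear characters and their multiplication action\<close>

definition linear_characters :: "('a \<Rightarrow> complex) set" where
  "linear_characters = {\<chi> \<in> Irr G. \<chi> \<one> = 1}"

lemma linear_character_rep:
  assumes "\<phi> \<in> linear_characters"
  obtains \<rho> where "complex_rep G (Suc 0) \<rho>" "\<And>g. g \<in> carrier G \<Longrightarrow> \<phi> g = \<rho> g $$ (0, 0)"
proof -
  obtain n \<rho> where r: "complex_rep G n \<rho>" "\<And>g. g \<in> carrier G \<Longrightarrow> \<phi> g = mat_trace (\<rho> g)" "\<phi> \<one> = of_nat n"
    using assms IrrE[of \<phi>] unfolding linear_characters_def by blast
  then have "n = Suc 0" using assms by (simp add: linear_characters_def)
  then show thesis
    using r(1,2) complex_repD(1)[OF r(1)] by (intro that) (auto simp: mat_trace_unit_carrier)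
qed

lemma linear_character_mult:
  assumes "\<phi> \<in> linear_characters" "g \<in> carrier G" "h \<in> carrier G"
  shows "\<phi> (g \<otimes> h) = \<phi> g * \<phi> h"
proof -
  obtain \<rho> where r: "complex_rep G (Suc 0) \<rho>" "\<And>g. g \<in> carrier G \<Longrightarrow> \<phi> g = \<rho> g $$ (0, 0)"
    using linear_character_rep[OF assms(1)] by blast
  then show ?thesis
    using complex_repD(1)[OF r(1) assms(2)] complex_repD(1)[OF r(1) assms(3)] complex_repD(2)[OF r(1) assms(2,3)] assms
    by (simp add: scalar_prod_def)
qed

lemma linear_character_mult_cnj:
  assumes l: "\<phi> \<in> linear_characters" and g: "g \<in> carrier G"
  shows "\<phi> g * cnj (\<phi> g) = 1"
proof -
  obtain n \<rho> where r: "complex_rep G n \<rho>" "\<And>g. g \<in> carrier G \<Longrightarrow> \<phi> g = mat_trace (\<rho> g)"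
    using l IrrE[of \<phi>] unfolding linear_characters_def by blast
  have "cnj (\<phi> g) = \<phi> (inv g)" using rep_trace_inv[OF r(1) g] r(2) g by simp
  then have "\<phi> g * cnj (\<phi> g) = \<phi> \<one>" using linear_character_mult[OF l g inv_closed[OF g]] g by simp
  then show ?thesis using l by (simp add: linear_characters_def)
qed

lemma norm_linear_character:
  assumes "\<phi> \<in> linear_characters" "g \<in> carrier G"
  shows "norm (\<phi> g) = 1"
proof -
  have "complex_of_real ((norm (\<phi> g))\<^sup>2) = 1"
    using linear_character_mult_cnj[OF assms] by (simp only: complex_norm_square)
  then have "(norm (\<phi> g))\<^sup>2 = 1" by (metis of_real_eq_1_iff)
  then show ?thesis using norm_ge_zero[of "\<phi> g"] by (metis abs_of_nonneg power2_eq_1_iff abs_minus abs_one)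
qed

text \<open>The restriction makes the product extensional, so that it can be literally an element of
  \<open>Irr G\<close>.\<close>

definition twist :: "('a \<Rightarrow> complex) \<Rightarrow> ('a \<Rightarrow> complex) \<Rightarrow> 'a \<Rightarrow> complex" where
  "twist \<phi> \<chi> = (\<lambda>g\<in>carrier G. \<phi> g * \<chi> g)"

text \<open>The scalar \<open>\<phi> g\<close> is nonzero and can be divided out, so a subspace
  invariant under the scaled representation is invariant under \<rho>.\<close>

lemma twist_in_Irr:
  assumes l: "\<phi> \<in> linear_characters" and c: "\<chi> \<in> Irr G"
  shows "twist \<phi> \<chi> \<in> Irr G"
proof -
  obtain n \<rho> where r: "irreducible_rep G n \<rho>" "complex_rep G n \<rho>" "n > 0"
      "\<And>g. g \<in> carrier G \<Longrightarrow> \<chi> g = mat_trace (\<rho> g)"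
    using IrrE[OF c] by metis
  note rD = complex_repD[OF r(2)]
  define \<tau> where "\<tau> g = \<phi> g \<cdot>\<^sub>m \<rho> g" for g
  have nz: "\<phi> g \<noteq> 0" if "g \<in> carrier G" for g using norm_linear_character[OF l that] by auto
  have "complex_rep G n \<tau>"
  proof (rule complex_repI)
    show "\<tau> g \<in> carrier_mat n n" if "g \<in> carrier G" for g using rD(1)[OF that] by (simp add: \<tau>_def)
    show "\<tau> \<one> = 1\<^sub>m n" using l rD(3) by (auto simp: \<tau>_def linear_characters_def)
    fix g h assume gh: "g \<in> carrier G" "h \<in> carrier G"
    have "\<tau> g * \<tau> h = \<phi> h \<cdot>\<^sub>m (\<phi> g \<cdot>\<^sub>m (\<rho> g * \<rho> h))"
      unfolding \<tau>_def using rD(1)[OF gh(1)] rD(1)[OF gh(2)]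
      by (simp add: mult_smult_assoc_mat[of _ n n _ n] mult_smult_distrib[of _ n n _ n])
    also have "\<dots> = \<tau> (g \<otimes> h)"
      unfolding \<tau>_def linear_character_mult[OF l gh] rD(2)[OF gh] by (intro eq_matI) auto
    finally show "\<tau> (g \<otimes> h) = \<tau> g * \<tau> h" ..
  qed
  moreover have "invariant_subspace G n \<rho> W" if W: "invariant_subspace G n \<tau> W" for W
  proof -
    have "\<rho> g *\<^sub>v w \<in> W" if g: "g \<in> carrier G" and w: "w \<in> W" for g w
    proof -
      have wc: "w \<in> carrier_vec n" using W w unfolding invariant_subspace_iff by blast
      have "\<rho> g *\<^sub>v w = inverse (\<phi> g) \<cdot>\<^sub>v (\<tau> g *\<^sub>v w)"
        using nz[OF g] rD(1)[OF g] wc by (intro eq_vecI) (auto simp: \<tau>_def smult_scalar_prod_distrib[of _ n])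
      moreover have "inverse (\<phi> g) \<cdot>\<^sub>v (\<tau> g *\<^sub>v w) \<in> W"
        using W g w unfolding invariant_subspace_iff by blast
      ultimately show ?thesis by simp
    qed
    then show ?thesis using W unfolding invariant_subspace_iff by blast
  qed
  ultimately have "irreducible_rep G n \<tau>"
    using r(1,3) unfolding irreducible_rep_def by blast
  moreover have "rep_character G \<tau> = twist \<phi> \<chi>"
    unfolding rep_character_def twist_def \<tau>_def
    by (intro restrict_ext) (simp add: r(4) mat_trace_smult[OF rD(1)])
  ultimately show ?thesis using rep_character_in_Irr by metis
qed

text \<open>Apply Bessel's inequality to \<open>\<mu>\<close> cut off outside \<open>A\<close>. The
  ratio is constant of norm 1 on \<open>A\<close>, so every \<phi> in \<open>F\<close> has a
  coefficient of norm \<open>card A\<close>, while the cut-off function has squared length only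
  \<open>card A\<close>. Cancelling one factor \<open>card A\<close> gives the bound.\<close>

lemma card_linear_characters_constant_ratio:
  assumes F: "F \<subseteq> linear_characters" and \<mu>: "\<mu> \<in> F" and A: "A \<subseteq> carrier G"
    and const: "\<And>\<phi> x y. \<phi> \<in> F \<Longrightarrow> x \<in> A \<Longrightarrow> y \<in> A \<Longrightarrow> \<mu> x * cnj (\<phi> x) = \<mu> y * cnj (\<phi> y)"
  shows "card F * card A \<le> order G"
proof (cases "A = {}")
  case False
  then obtain a where a: "a \<in> A" by blast
  have Irr: "F \<subseteq> Irr G" using F by (auto simp: linear_characters_def)
  have finA: "finite A" using A finite_carrier finite_subset by blast
  let ?v = "\<lambda>g. if g \<in> A then \<mu> g else 0"
  have restr: "(\<Sum>g\<in>carrier G. if g \<in> A then f g else 0) = sum f A" for f :: "'a \<Rightarrow> 'c::comm_monoid_add"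
    using A finite_carrier by (simp add: sum.inter_restrict[symmetric] Int_absorb1)
  have coef: "(norm (\<Sum>g\<in>carrier G. ?v g * cnj (\<phi> g)))\<^sup>2 = (real (card A))\<^sup>2" if \<phi>: "\<phi> \<in> F" for \<phi>
  proof -
    have "(\<Sum>g\<in>carrier G. ?v g * cnj (\<phi> g)) = (\<Sum>g\<in>A. \<mu> g * cnj (\<phi> g))"
      by (subst restr[symmetric], intro sum.cong) auto
    also have "\<dots> = (\<Sum>g\<in>A. \<mu> a * cnj (\<phi> a))" by (intro sum.cong refl const \<phi> a)
    also have "\<dots> = of_nat (card A) * (\<mu> a * cnj (\<phi> a))" by simp
    finally have "norm (\<Sum>g\<in>carrier G. ?v g * cnj (\<phi> g)) = real (card A)"
      using norm_linear_character F \<mu> \<phi> a A by (simp add: norm_mult subset_eq)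
    then show ?thesis by simp
  qed
  have "real (card F) * (real (card A))\<^sup>2 = (\<Sum>\<phi>\<in>F. (norm (\<Sum>g\<in>carrier G. ?v g * cnj (\<phi> g)))\<^sup>2)"
    using coef by simp
  also have "\<dots> \<le> real (order G) * (\<Sum>g\<in>carrier G. (norm (?v g))\<^sup>2)"
    using Irr finite_subset[OF Irr finite_Irr] by (intro bessel_inequality Irr_orthogonality) auto
  also have "(\<Sum>g\<in>carrier G. (norm (?v g))\<^sup>2) = (\<Sum>g\<in>A. (norm (\<mu> g))\<^sup>2)"
    by (subst restr[symmetric], intro sum.cong) auto
  also have "\<dots> = (\<Sum>g\<in>A. 1)"
  proof (rule sum.cong[OF refl])
    fix g assume "g \<in> A"
    then have "norm (\<mu> g) = 1" using norm_linear_character[of \<mu> g] F \<mu> A by blast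
    then show "(norm (\<mu> g))\<^sup>2 = 1" by simp
  qed
  finally have "real (card F) * real (card A) * real (card A) \<le> real (order G) * real (card A)"
    by (simp add: power2_eq_square mult.assoc)
  moreover have "card A > 0" using a finA by (auto simp: card_gt_0_iff)
  ultimately have "real (card F) * real (card A) \<le> real (order G)" by simp
  then show ?thesis by (metis of_nat_le_iff of_nat_mult)
qed simp

section \<open>Conjugacy classes on which a character vanishes\<close>

lemma conj_classE:
  assumes "C \<in> conj_classes G"
  obtains a where "a \<in> carrier G" "C = {g \<otimes> a \<otimes> inv g | g. g \<in> carrier G}"
proof -
  obtain a where a: "a \<in> carrier G" "C = orbit G (\<lambda>g. \<lambda>h\<in>carrier G. g \<otimes> h \<otimes> inv g) a"
    using assms by (auto simp: conj_classes_def orbits_def)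
  then have "C = {g \<otimes> a \<otimes> inv g | g. g \<in> carrier G}" by (auto simp: orbit_def)
  with a(1) show thesis by (rule that)
qed

lemma Union_conj_classes: "\<Union>(conj_classes G) = carrier G"
  unfolding conj_classes_def by (rule group_action.orbits_coverture[OF action_by_conjugation])

lemma disjoint_conj_classes:
  "C \<in> conj_classes G \<Longrightarrow> D \<in> conj_classes G \<Longrightarrow> C \<noteq> D \<Longrightarrow> C \<inter> D = {}"
  unfolding conj_classes_def using group_action.disjoint_union[OF action_by_conjugation] by blast

lemma finite_conj_classes: "finite (conj_classes G)"
  using finite_carrier Union_conj_classes by (intro finite_UnionD) simp

lemma Irr_constant_on_conj_class:
  assumes "\<chi> \<in> Irr G" "C \<in> conj_classes G" "x \<in> C" "y \<in> C"
  shows "\<chi> x = \<chi> y"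
  using conj_classE[OF assms(2)] Irr_class_function[OF assms(1)] assms(3,4) by (smt (verit) mem_Collect_eq)

definition zero_classes :: "('a \<Rightarrow> complex) \<Rightarrow> 'a set set" where
  "zero_classes \<chi> = {C \<in> conj_classes G. \<forall>g\<in>C. \<chi> g = 0}"

lemma finite_zero_classes: "finite (zero_classes \<chi>)"
  using finite_conj_classes by (simp add: zero_classes_def)

lemma Union_zero_classes:
  assumes "\<chi> \<in> Irr G"
  shows "\<Union>(zero_classes \<chi>) = {g \<in> carrier G. \<chi> g = 0}"
proof (intro equalityI subsetI)
  fix g assume g: "g \<in> {g \<in> carrier G. \<chi> g = 0}"
  then obtain C where C: "C \<in> conj_classes G" "g \<in> C" using Union_conj_classes by blast
  then have "\<forall>h\<in>C. \<chi> h = 0" using Irr_constant_on_conj_class[OF assms C(1) C(2)] g by fastforce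
  then show "g \<in> \<Union>(zero_classes \<chi>)" using C by (auto simp: zero_classes_def)
qed (use Union_conj_classes in \<open>auto simp: zero_classes_def\<close>)

lemma nz_eq: "nz G = (\<Sum>\<chi>\<in>Irr G. card (zero_classes \<chi>))"
proof -
  have "{(\<chi>, C). \<chi> \<in> Irr G \<and> C \<in> conj_classes G \<and> (\<forall>g\<in>C. \<chi> g = 0)} = Sigma (Irr G) zero_classes"
    by (auto simp: zero_classes_def)
  then show ?thesis
    unfolding nz_def using finite_Irr finite_zero_classes by (simp add: card_SigmaI)
qed

text \<open>Two linear characters with the same twist of \<open>\<chi>\<close> agree wherever \<open>\<chi>\<close> does not vanish.
  Bessel's inequality is applied to each zero class of \<open>\<chi>\<close> and to the complement of their union;
  these sets partition the group.\<close>

lemma card_twist_fibre_le: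
  assumes c: "\<chi> \<in> Irr G"
  shows "card {\<phi> \<in> linear_characters. twist \<phi> \<chi> = \<psi>} \<le> card (zero_classes \<chi>) + 1"
proof (cases "{\<phi> \<in> linear_characters. twist \<phi> \<chi> = \<psi>} = {}")
  case False
  let ?F = "{\<phi> \<in> linear_characters. twist \<phi> \<chi> = \<psi>}"
  let ?Z = "{g \<in> carrier G. \<chi> g = 0}"
  let ?K = "carrier G - ?Z"
  obtain \<mu> where \<mu>: "\<mu> \<in> ?F" using False by blast
  have F: "?F \<subseteq> linear_characters" by blast
  have K: "card ?F * card ?K \<le> order G"
  proof (rule card_linear_characters_constant_ratio[OF F \<mu>])
    have 1: "\<mu> x * cnj (\<phi> x) = 1" if "\<phi> \<in> ?F" "x \<in> ?K" for \<phi> x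
    proof -
      have "twist \<phi> \<chi> = twist \<mu> \<chi>" using that \<mu> by simp
      then have "twist \<phi> \<chi> x = twist \<mu> \<chi> x" by (rule fun_cong)
      then have "\<phi> x * \<chi> x = \<mu> x * \<chi> x" using that(2) by (simp add: twist_def)
      then have "\<mu> x = \<phi> x" using that by simp
      then show ?thesis using linear_character_mult_cnj[of \<phi> x] that by simp
    qed
    then show "\<mu> x * cnj (\<phi> x) = \<mu> y * cnj (\<phi> y)" if "\<phi> \<in> ?F" "x \<in> ?K" "y \<in> ?K" for \<phi> x y
      using that by simp
  qed blast
  have "card ?F * card C \<le> order G" if C: "C \<in> zero_classes \<chi>" for C
  proof (rule card_linear_characters_constant_ratio[OF F \<mu>])
    have C': "C \<in> conj_classes G" using C by (simp add: zero_classes_def)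
    show "C \<subseteq> carrier G" using C' Union_conj_classes by blast
    \<comment> \<open>On a zero class the equation of twists carries no information; the ratio is
      constant there because both characters are class functions.\<close>
    show "\<mu> x * cnj (\<phi> x) = \<mu> y * cnj (\<phi> y)" if "\<phi> \<in> ?F" "x \<in> C" "y \<in> C" for \<phi> x y
    proof -
      have "\<mu> \<in> Irr G" "\<phi> \<in> Irr G" using that(1) \<mu> by (auto simp: linear_characters_def)
      then show ?thesis
        using Irr_constant_on_conj_class[OF _ C' that(2,3)] by metis
    qed
  qed
  then have Z: "(\<Sum>C\<in>zero_classes \<chi>. card ?F * card C) \<le> card (zero_classes \<chi>) * order G"
    using sum_bounded_above[of "zero_classes \<chi>" "\<lambda>C. card ?F * card C" "order G"] by simp
  have cZ: "(\<Sum>C\<in>zero_classes \<chi>. card C) = card ?Z"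
  proof -
    have "card (\<Union>(zero_classes \<chi>)) = (\<Sum>C\<in>zero_classes \<chi>. card C)"
    proof (rule card_Union_disjoint)
      show "pairwise disjnt (zero_classes \<chi>)"
        using disjoint_conj_classes by (auto simp: pairwise_def disjnt_def zero_classes_def)
      fix C assume "C \<in> zero_classes \<chi>"
      then have "C \<subseteq> carrier G" using Union_conj_classes by (auto simp: zero_classes_def)
      then show "finite C" using finite_carrier by (rule finite_subset)
    qed
    then show ?thesis by (simp add: Union_zero_classes[OF c])
  qed
  have ZK: "card ?Z + card ?K = order G"
    using finite_carrier card_Un_disjoint[of ?Z ?K] by (simp add: Coset.order_def Un_absorb1 Int_commute)
  \<comment> \<open>Each zero class contributes at most one \<open>order G\<close>, and the
    complement contributes the extra one, the \<open>+ 1\<close> of the claim.\<close>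
  have "card ?F * order G = card ?F * card ?Z + card ?F * card ?K"
    unfolding ZK[symmetric] by (rule add_mult_distrib2)
  also have "\<dots> \<le> card (zero_classes \<chi>) * order G + order G"
    using Z K unfolding sum_distrib_left[symmetric] cZ by (rule add_mono)
  also have "\<dots> = (card (zero_classes \<chi>) + 1) * order G" by simp
  finally have "card ?F * order G \<le> (card (zero_classes \<chi>) + 1) * order G" .
  then show ?thesis using order_pos by (simp only: mult_le_cancel2)
qed (simp only: card.empty)

end

section \<open>Nonlinear characters of nonabelian groups\<close>

text \<open>The columns of \<open>P\<close> are a basis of \<open>W\<close> followed by vectors
  completing it to a basis of the whole space, and \<open>Q\<close> reads off coordinates. In these
  coordinates an operator preserving \<open>W\<close> has a zero block below the first
  \<open>k\<close> rows and columns.\<close>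

lemma adapted_basis:
  fixes W :: "complex vec set"
  assumes W: "W \<subseteq> carrier_vec n" "0\<^sub>v n \<in> W" "\<And>v w. v \<in> W \<Longrightarrow> w \<in> W \<Longrightarrow> v + w \<in> W"
      "\<And>c v. v \<in> W \<Longrightarrow> c \<cdot>\<^sub>v v \<in> W"
    and proper: "W \<noteq> {0\<^sub>v n}" "W \<noteq> carrier_vec n"
  obtains k P Q where "0 < k" "k < n" "P \<in> carrier_mat n n" "Q \<in> carrier_mat n n"
    "P * Q = 1\<^sub>m n" "Q * P = 1\<^sub>m n" "\<And>j. j < k \<Longrightarrow> col P j \<in> W"
    "\<And>w i. w \<in> W \<Longrightarrow> k \<le> i \<Longrightarrow> i < n \<Longrightarrow> (Q *\<^sub>v w) $ i = 0"
proof -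
  interpret vec_space "TYPE(complex)" n .
  have sub: "submodule class_ring U V"
    if "U \<subseteq> carrier_vec n" "0\<^sub>v n \<in> U" "\<And>v w. v \<in> U \<Longrightarrow> w \<in> U \<Longrightarrow> v + w \<in> U"
      "\<And>c v. v \<in> U \<Longrightarrow> c \<cdot>\<^sub>v v \<in> U" for U
    using that vec_module[of n, where 'a=complex]
    unfolding submodule_def by (auto simp: module_vec_simps class_ring_simps)
  have bound: "finite S \<and> card S \<le> n" if "S \<subseteq> carrier_vec n" "lin_indpt S" for S
    using li_le_dim[OF fin_dim] that dim_is_n by auto
  have "lin_indpt {}" by (simp add: lin_dep_def)
  \<comment> \<open>Independent subsets have at most \<open>n\<close> elements, so a maximal one
    inside \<open>W\<close> exists; by maximality it spans \<open>W\<close>.\<close>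
  then obtain A where A: "finite A" "maximal A (\<lambda>S. S \<subseteq> W \<and> lin_indpt S)"
    using maximal_exists[of "\<lambda>S. S \<subseteq> W \<and> lin_indpt S" n "{}"] bound W(1) by blast
  then have AW: "A \<subseteq> W" and Ali: "lin_indpt A" by (auto simp: maximal_def)
  then have Ac: "A \<subseteq> carrier_vec n" using W(1) by blast
  have spanA: "W \<subseteq> span A"
  proof
    fix w assume w: "w \<in> W"
    show "w \<in> span A"
    proof (rule ccontr)
      assume n: "w \<notin> span A"
      then have "w \<notin> A" using in_own_span[OF Ac] by blast
      then have "lin_indpt (A \<union> {w})"
        using lin_dep_iff_in_span[of A w] Ac Ali w W(1) n by auto
      then have "A \<union> {w} = A"
        using A(2) AW w unfolding maximal_def by blast
      then show False using \<open>w \<notin> A\<close> by blast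
    qed
  qed
  have spanA': "span A \<subseteq> W" by (rule span_is_subset[OF AW sub[OF W]])
  obtain B where B: "finite B" "maximal B (\<lambda>S. A \<subseteq> S \<and> S \<subseteq> carrier_vec n \<and> lin_indpt S)"
    using maximal_exists[of "\<lambda>S. A \<subseteq> S \<and> S \<subseteq> carrier_vec n \<and> lin_indpt S" n A] bound Ac Ali by blast
  then have AB: "A \<subseteq> B" and Bc: "B \<subseteq> carrier_vec n" and Bli: "lin_indpt B"
    by (auto simp: maximal_def)
  \<comment> \<open>Any set above \<open>B\<close> also contains \<open>A\<close>, so maximality
    among extensions of \<open>A\<close> is maximality among all independent sets.\<close>
  have "maximal B (\<lambda>S. S \<subseteq> carrier_vec n \<and> lin_indpt S)"
    using B(2) unfolding maximal_def by blast
  then have "basis B" using max_li_is_basis by auto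
  then have cardB: "card B = n" using dim_basis[OF B(1)] dim_is_n by simp
  obtain as where as: "set as = A" "distinct as" using A(1) finite_distinct_list by blast
  obtain bs where bs: "set bs = B - A" "distinct bs" using B(1) finite_distinct_list by (metis finite_Diff)
  define ls where "ls = as @ bs"
  define k where "k = length as"
  define P where "P = mat_of_cols n ls"
  have ls: "set ls = B" "distinct ls" using as bs AB by (auto simp: ls_def)
  then have len: "length ls = n" using cardB distinct_card by metis
  have P: "P \<in> carrier_mat n n" using mat_of_cols_carrier(1)[of n ls] by (simp add: P_def len)
  have cols: "cols P = ls" unfolding P_def using ls Bc by (intro cols_mat_of_cols) auto
  have colP: "col P j = ls ! j" if "j < n" for j
    using that P cols by (metis carrier_matD(2) cols_length cols_nth)
  have "rank P = n" using lin_indpt_full_rank[OF P] cols ls Bli by simp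
  then have "det P \<noteq> 0" using det_rank_iff[OF P] by simp
  then have "P \<in> Units (ring_mat TYPE(complex) n ())" by (rule det_non_zero_imp_unit[OF P])
  then obtain Q where Q: "Q \<in> carrier_mat n n" "Q * P = 1\<^sub>m n" "P * Q = 1\<^sub>m n"
    by (auto simp: Units_def ring_mat_def)
  have kn: "k \<le> n" using len by (simp add: k_def ls_def)
  have in_A: "ls ! j \<in> A" if "j < k" for j
    using that as nth_mem[of j as] by (simp add: ls_def k_def nth_append)
  have "0 < k"
  proof (rule ccontr)
    assume "\<not> 0 < k"
    then have "A = {}" using as by (simp add: k_def)
    then have "W \<subseteq> {0\<^sub>v n}" using spanA span_empty by auto
    with W(2) proper(1) show False by blast
  qed
  moreover have "k < n"
  proof (rule ccontr)
    assume "\<not> k < n"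
    then have "length bs = 0" using len unfolding k_def ls_def length_append by linarith
    then have "bs = []" by simp
    then have "B = A" using bs AB by auto
    then have "span A = carrier_vec n" using \<open>basis B\<close> by (simp add: basis_def)
    with spanA' W(1) proper(2) show False by blast
  qed
  moreover have "col P j \<in> W" if "j < k" for j
    using that in_A AW colP kn by auto
  moreover have "(Q *\<^sub>v w) $ i = 0" if w: "w \<in> W" and i: "k \<le> i" "i < n" for w i
  proof -
    let ?U = "{v \<in> carrier_vec n. (Q *\<^sub>v v) $ i = 0}"
    \<comment> \<open>The vectors whose \<open>i\<close>-th coordinate vanishes form a subspace, so
      it suffices to check the basis vectors of \<open>W\<close>.\<close>
    have "submodule class_ring ?U V"
      using Q(1) i by (intro sub) (auto simp: scalar_prod_add_distrib[of _ n])
    moreover have "A \<subseteq> ?U"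
    proof
      fix a assume a: "a \<in> A"
      then obtain j where j: "j < k" "a = as ! j" using as by (metis in_set_conv_nth k_def)
      then have "a = col P j" using colP kn by (simp add: ls_def k_def nth_append)
      then have "Q *\<^sub>v a = col (Q * P) j" using col_mult2[OF Q(1) P] j kn by simp
      then show "a \<in> ?U" using Q(2) j i a Ac by auto
    qed
    ultimately have "span A \<subseteq> ?U" by (intro span_is_subset)
    then show ?thesis using spanA w by blast
  qed
  ultimately show thesis using that P Q by blast
qed

context group
begin

text \<open>Traces add up over an invariant subspace and its quotient, so no invariant complement is needed.\<close>

lemma trace_eq_dim_if_irreducible:
  assumes x: "x \<in> carrier G"
    and irr: "\<And>n \<rho>. irreducible_rep G n \<rho> \<Longrightarrow> mat_trace (\<rho> x) = of_nat n"
  shows "complex_rep G n \<rho> \<Longrightarrow> mat_trace (\<rho> x) = of_nat n"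
proof (induction n arbitrary: \<rho> rule: less_induct)
  case (less n)
  note rD = complex_repD[OF less.prems]
  show ?case
  \<comment> \<open>Degree 0 does not count as irreducible and is settled by the empty
    trace.\<close>
  proof (cases "irreducible_rep G n \<rho> \<or> n = 0")
    case True
    then show ?thesis using irr rD(1)[OF x] by (auto simp: mat_trace_def)
  next
    case False
    then obtain W where W: "invariant_subspace G n \<rho> W" "W \<noteq> {0\<^sub>v n}" "W \<noteq> carrier_vec n"
      using less.prems unfolding irreducible_rep_def by blast
    then have inv: "\<And>g w. g \<in> carrier G \<Longrightarrow> w \<in> W \<Longrightarrow> \<rho> g *\<^sub>v w \<in> W"
      unfolding invariant_subspace_iff by blast
    obtain k P Q where k: "0 < k" "k < n" and P: "P \<in> carrier_mat n n" and Q: "Q \<in> carrier_mat n n"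
      and PQ: "P * Q = 1\<^sub>m n" "Q * P = 1\<^sub>m n" and col: "\<And>j. j < k \<Longrightarrow> col P j \<in> W"
      and coord: "\<And>w i. w \<in> W \<Longrightarrow> k \<le> i \<Longrightarrow> i < n \<Longrightarrow> (Q *\<^sub>v w) $ i = 0"
      using adapted_basis[of W n] W unfolding invariant_subspace_iff by (metis (no_types, lifting))
    define M where "M g = Q * \<rho> g * P" for g
    have Mc: "M g \<in> carrier_mat n n" if "g \<in> carrier G" for g
      using P Q rD(1)[OF that] by (simp add: M_def)
    have Mmult: "M (g \<otimes> h) = M g * M h" if "g \<in> carrier G" "h \<in> carrier G" for g h
    proof -
      note c = rD(1)[OF that(1)] rD(1)[OF that(2)]
      have "M g * M h = Q * \<rho> g * (P * Q) * \<rho> h * P"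
        unfolding M_def using P Q c by (simp add: assoc_mult_mat[of _ n n _ n _ n])
      also have "\<dots> = M (g \<otimes> h)"
        unfolding M_def PQ rD(2)[OF that] using P Q c by (simp add: assoc_mult_mat[of _ n n _ n _ n])
      finally show ?thesis ..
    qed
    have Mone: "M \<one> = 1\<^sub>m n" using P Q PQ by (simp add: M_def rD(3))
    have Mzero: "M g $$ (i, j) = 0" if g: "g \<in> carrier G" and ij: "k \<le> i" "i < n" "j < k" for g i j
    proof -
      have Pj: "col P j \<in> carrier_vec n" using P by auto
      have "M g $$ (i, j) = col (M g) j $ i" using Mc[OF g] ij k by simp
      also have "col (M g) j = (Q * \<rho> g) *\<^sub>v col P j"
        unfolding M_def using P Q rD(1)[OF g] ij k by (intro col_mult2[of _ n n _ n]) auto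
      also have "\<dots> = Q *\<^sub>v (\<rho> g *\<^sub>v col P j)"
        using Q rD(1)[OF g] Pj by (rule assoc_mult_mat_vec)
      also have "\<dots> $ i = 0" by (rule coord[OF inv[OF g col[OF ij(3)]] ij(1,2)])
      finally show ?thesis .
    qed
    have entry: "M (g \<otimes> h) $$ (i, j) = (\<Sum>c<n. M g $$ (i, c) * M h $$ (c, j))"
      if "g \<in> carrier G" "h \<in> carrier G" "i < n" "j < n" for g h i j
      using Mc[OF that(1)] Mc[OF that(2)] that unfolding Mmult[OF that(1,2)] by (auto simp: scalar_prod_def lessThan_atLeast0)
    have split: "(\<Sum>c<n. f c) = (\<Sum>c<k. f c) + (\<Sum>c<n - k. f (c + k))" for f :: "nat \<Rightarrow> complex"
    proof -
      have "(\<Sum>c<n. f c) = (\<Sum>c\<in>{..<k} \<union> {k..<n}. f c)" using k by (intro sum.cong) auto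
      also have "\<dots> = (\<Sum>c<k. f c) + (\<Sum>c\<in>{k..<n}. f c)" by (intro sum.union_disjoint) auto
      also have "(\<Sum>c\<in>{k..<n}. f c) = (\<Sum>c<n - k. f (c + k))"
        by (rule sum.reindex_bij_witness[of _ "\<lambda>c. c + k" "\<lambda>c. c - k"]) auto
      finally show ?thesis .
    qed
    \<comment> \<open>With the lower left block zero, both diagonal blocks are multiplicative:
      \<open>A\<close> is the action on \<open>W\<close> and \<open>D\<close> the action on the
      quotient by \<open>W\<close>.\<close>
    define A where "A g = mat k k (\<lambda>(i, j). M g $$ (i, j))" for g
    define D where "D g = mat (n - k) (n - k) (\<lambda>(i, j). M g $$ (i + k, j + k))" for g
    have "complex_rep G k A"
    proof (rule complex_repI)
      show "A \<one> = 1\<^sub>m k" using k by (auto simp: A_def Mone)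
      show "A (g \<otimes> h) = A g * A h" if gh: "g \<in> carrier G" "h \<in> carrier G" for g h
      proof (rule eq_matI)
        fix i j assume "i < dim_row (A g * A h)" "j < dim_col (A g * A h)"
        then have ij: "i < k" "j < k" by (auto simp: A_def)
        then show "A (g \<otimes> h) $$ (i, j) = (A g * A h) $$ (i, j)"
          using entry[OF gh, of i j] k Mzero[OF gh(2)]
          by (simp add: A_def split scalar_prod_def lessThan_atLeast0[symmetric])
      qed (auto simp: A_def)
    qed (simp add: A_def)
    moreover have "complex_rep G (n - k) D"
    proof (rule complex_repI)
      show "D \<one> = 1\<^sub>m (n - k)" using k by (auto simp: D_def Mone)
      show "D (g \<otimes> h) = D g * D h" if gh: "g \<in> carrier G" "h \<in> carrier G" for g h
      proof (rule eq_matI)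
        fix i j assume "i < dim_row (D g * D h)" "j < dim_col (D g * D h)"
        then have ij: "i < n - k" "j < n - k" by (auto simp: D_def)
        then show "D (g \<otimes> h) $$ (i, j) = (D g * D h) $$ (i, j)"
          using entry[OF gh, of "i + k" "j + k"] k Mzero[OF gh(1)]
          by (simp add: D_def split scalar_prod_def lessThan_atLeast0[symmetric])
      qed (auto simp: D_def)
    qed (simp add: D_def)
    ultimately have "mat_trace (A x) = of_nat k" "mat_trace (D x) = of_nat (n - k)"
      using less.IH[of k A] less.IH[of "n - k" D] k by simp_all
    moreover have "mat_trace (M x) = mat_trace (A x) + mat_trace (D x)"
      using Mc[OF x] by (simp add: mat_trace_def A_def D_def split)
    moreover have "mat_trace (M x) = mat_trace (\<rho> x)"
      unfolding M_def by (rule mat_trace_conj[OF rD(1)[OF x] Q P PQ(1)])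
    ultimately show ?thesis using k by (simp flip: of_nat_add)
  qed
qed

end

section \<open>Existence of a nonlinear character\<close>

context finite_group
begin

text \<open>This is the regular representation by permutation matrices: left multiplication by a
  nonidentity element fixes no element, so its diagonal is zero.\<close>

lemma regular_rep_exists:
  obtains \<rho> where "complex_rep G (order G) \<rho>" "\<And>x. x \<in> carrier G \<Longrightarrow> x \<noteq> \<one> \<Longrightarrow> mat_trace (\<rho> x) = 0"
proof -
  let ?N = "order G"
  obtain e where e: "bij_betw e {..<?N} (carrier G)"
    using ex_bij_betw_nat_finite[OF finite_carrier] by (auto simp: Coset.order_def lessThan_atLeast0)
  have ec: "e i \<in> carrier G" if "i < ?N" for i using e that by (auto simp: bij_betw_def)
  have einj: "e i = e j \<longleftrightarrow> i = j" if "i < ?N" "j < ?N" for i j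
    using e that by (auto simp: bij_betw_def inj_on_def)
  have esurj: "\<exists>i<?N. e i = g" if "g \<in> carrier G" for g using e that by (force simp: bij_betw_def)
  define \<rho> where "\<rho> g = mat ?N ?N (\<lambda>(i, j). if e i = g \<otimes> e j then 1 else 0 :: complex)" for g
  have "complex_rep G ?N \<rho>"
  proof (rule complex_repI)
    show "\<rho> \<one> = 1\<^sub>m ?N" using ec einj by (intro eq_matI) (auto simp: \<rho>_def)
    show "\<rho> (g \<otimes> h) = \<rho> g * \<rho> h" if gh: "g \<in> carrier G" "h \<in> carrier G" for g h
    proof (rule eq_matI)
      fix i j assume "i < dim_row (\<rho> g * \<rho> h)" "j < dim_col (\<rho> g * \<rho> h)"
      then have ij: "i < ?N" "j < ?N" by (auto simp: \<rho>_def)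
      obtain c where c: "c < ?N" "e c = h \<otimes> e j" using esurj[of "h \<otimes> e j"] ec[OF ij(2)] gh by auto
      have "(\<rho> g * \<rho> h) $$ (i, j) =
          (\<Sum>c<?N. (if e i = g \<otimes> e c then 1 else 0) * (if e c = h \<otimes> e j then 1 else 0))"
        using ij by (simp add: \<rho>_def scalar_prod_def lessThan_atLeast0)
      also have "\<dots> = (\<Sum>d<?N. if d = c then (if e i = g \<otimes> e c then 1 else 0) else 0)"
        using einj[OF _ c(1)] unfolding c(2)[symmetric] by (intro sum.cong) auto
      also have "\<dots> = (if e i = g \<otimes> (h \<otimes> e j) then 1 else 0)" using c by simp
      finally show "\<rho> (g \<otimes> h) $$ (i, j) = (\<rho> g * \<rho> h) $$ (i, j)"
        using ij gh ec[OF ij(2)] by (simp add: \<rho>_def m_assoc)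
    qed (auto simp: \<rho>_def)
  qed (simp add: \<rho>_def)
  moreover have "mat_trace (\<rho> x) = 0" if "x \<in> carrier G" "x \<noteq> \<one>" for x
  proof -
    have "e i \<noteq> x \<otimes> e i" if "i < ?N" for i
      using ec[OF that] \<open>x \<in> carrier G\<close> \<open>x \<noteq> \<one>\<close> by simp
    then show ?thesis by (simp add: mat_trace_def \<rho>_def)
  qed
  ultimately show thesis by (rule that)
qed

lemma nonlinear_irreducible_exists:
  assumes "\<not> comm_group G"
  shows "\<exists>n \<rho>. irreducible_rep G n \<rho> \<and> n > 1"
proof (rule ccontr)
  assume "\<not> ?thesis"
  then have dim: "n = 1" if "irreducible_rep G n \<rho>" for n \<rho>
  proof -
    have "\<not> n > 1" using \<open>\<not> (\<exists>n \<rho>. irreducible_rep G n \<rho> \<and> n > 1)\<close> that by blast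
    then show ?thesis using irreducible_repD(2)[OF that] by linarith
  qed
  obtain g h where gh: "g \<in> carrier G" "h \<in> carrier G" "g \<otimes> h \<noteq> h \<otimes> g"
    using assms group_comm_groupI by blast
  \<comment> \<open>A nontrivial commutator: representations of degree 1 send it to the identity
    matrix.\<close>
  define x where "x = g \<otimes> h \<otimes> inv (h \<otimes> g)"
  have x: "x \<in> carrier G" "x \<noteq> \<one>"
    using gh by (auto simp: x_def) (metis inv_closed inv_equality inv_inv m_closed)
  have "mat_trace (\<rho> x) = of_nat n" if r: "irreducible_rep G n \<rho>" for n \<rho>
  proof -
    note r' = irreducible_repD(1)[OF r]
    note rD = complex_repD[OF r']
    have "\<rho> g * \<rho> h = \<rho> h * \<rho> g"
      using dim[OF r] rD(1)[OF gh(1)] rD(1)[OF gh(2)]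
      by (intro eq_matI) (auto simp: scalar_prod_def mult.commute)
    then have "\<rho> (g \<otimes> h) = \<rho> (h \<otimes> g)" using rD(2) gh by simp
    then have "\<rho> x = \<rho> (h \<otimes> g) * \<rho> (inv (h \<otimes> g))" using rD(2) gh by (simp add: x_def)
    also have "\<dots> = 1\<^sub>m n" using complex_rep_inv(1)[OF r'] gh by simp
    finally show ?thesis by simp
  qed
  then have all: "mat_trace (\<rho> x) = of_nat n" if "complex_rep G n \<rho>" for n \<rho>
    using trace_eq_dim_if_irreducible[OF x(1)] that by blast
  obtain \<rho> where "complex_rep G (order G) \<rho>" "mat_trace (\<rho> x) = 0"
    using regular_rep_exists x by metis
  then show False using all order_pos by fastforce
qed

end

section \<open>Counting zeros\<close>

context finite_group
begin

text \<open>Guards against vacuous zeros: an empty class would satisfy the vanishing condition for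
  every character.\<close>

lemma conj_class_nonempty: "C \<in> conj_classes G \<Longrightarrow> \<exists>g\<in>carrier G. g \<in> C"
  by (erule conj_classE) (use one_closed m_closed inv_closed in blast)

lemma zero_classes_empty_if_abelian:
  assumes comm: "comm_group G" and c: "\<chi> \<in> Irr G"
  shows "zero_classes \<chi> = {}"
proof -
  interpret comm_group G by (rule comm)
  obtain n \<rho> where r: "irreducible_rep G n \<rho>" "complex_rep G n \<rho>" "n > 0"
      "\<And>g. g \<in> carrier G \<Longrightarrow> \<chi> g = mat_trace (\<rho> g)"
    using IrrE[OF c] by metis
  note rD = complex_repD[OF r(2)]
  have nz: "\<chi> h \<noteq> 0" if h: "h \<in> carrier G" for h
  proof -
    have "\<rho> h * \<rho> g = \<rho> g * \<rho> h" if "g \<in> carrier G" for g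
      using rD(2) h that m_comm[OF h that] by metis
    then obtain a where a: "\<rho> h = a \<cdot>\<^sub>m 1\<^sub>m n"
      using schur_lemma_scalar[OF r(1) rD(1)[OF h]] by blast
    have "a \<noteq> 0"
    proof
      assume "a = 0"
      then have "\<rho> h = 0\<^sub>m n n" unfolding a by (intro eq_matI) auto
      then have "1\<^sub>m n = (0\<^sub>m n n :: complex mat)"
        using complex_rep_inv(1)[OF r(2) h] rD(1)[OF inv_closed[OF h]] by simp
      then have "(1\<^sub>m n :: complex mat) $$ (0, 0) = 0\<^sub>m n n $$ (0, 0)" by simp
      with r(3) show False by simp
    qed
    then show ?thesis
      using r(3,4) h mat_trace_smult[OF one_carrier_mat, of a n] by (simp add: a)
  qed
  have "C \<notin> zero_classes \<chi>" for C
    using conj_class_nonempty[of C] nz unfolding zero_classes_def by blast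
  then show ?thesis by blast
qed

lemma nz_ge_nonlinear: "card (Irr G - linear_characters) \<le> nz G"
proof -
  have "1 \<le> card (zero_classes \<chi>)" if c: "\<chi> \<in> Irr G - linear_characters" for \<chi>
  proof -
    obtain n \<rho> where r: "irreducible_rep G n \<rho>" "n > 0" "\<chi> \<one> = of_nat n"
        "\<And>g. g \<in> carrier G \<Longrightarrow> \<chi> g = mat_trace (\<rho> g)"
      using IrrE[of \<chi>] c by (metis DiffD1)
    then have "n \<noteq> 1" using c by (auto simp: linear_characters_def)
    then have "n > 1" using r(2) by simp
    then obtain g where "g \<in> carrier G" "\<chi> g = 0" using burnside_zero[OF r(1)] r(4) by metis
    then have "\<Union>(zero_classes \<chi>) \<noteq> {}" using Union_zero_classes[of \<chi>] c by blast
    then have "zero_classes \<chi> \<noteq> {}" by blast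
    then show ?thesis using finite_zero_classes by (simp add: Suc_le_eq card_gt_0_iff)
  qed
  then have "card (Irr G - linear_characters) \<le> (\<Sum>\<chi>\<in>Irr G - linear_characters. card (zero_classes \<chi>))"
    using sum_mono[of "Irr G - linear_characters" "\<lambda>_. 1" "\<lambda>\<chi>. card (zero_classes \<chi>)"] by simp
  also have "\<dots> \<le> nz G"
    unfolding nz_eq using finite_Irr by (intro sum_mono2) auto
  finally show ?thesis .
qed

text \<open>A charging argument over the orbit of \<chi>. Each fibre of the twisting map costs one
  unit plus the zeros of \<chi>, and these are charged to the image \<psi>, which has the same zeros
  because linear characters never vanish. Different \<psi> own different pairs in \<open>nz\<close>,
  and the units are counted by the orbit, which consists of nonlinear characters.\<close>

lemma card_linear_characters_le:
  assumes c: "\<chi> \<in> Irr G - linear_characters"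
  shows "card linear_characters \<le> nz G + card (Irr G - linear_characters)"
proof -
  let ?L = "linear_characters"
  let ?O = "(\<lambda>\<phi>. twist \<phi> \<chi>) ` ?L"
  have LI: "?L \<subseteq> Irr G" by (auto simp: linear_characters_def)
  then have finL: "finite ?L" using finite_Irr by (rule finite_subset)
  have OI: "?O \<subseteq> Irr G - ?L"
  proof
    fix \<psi> assume "\<psi> \<in> ?O"
    then obtain \<phi> where \<phi>: "\<phi> \<in> ?L" "\<psi> = twist \<phi> \<chi>" by blast
    then have "\<psi> \<one> = \<chi> \<one>" by (simp add: twist_def linear_characters_def)
    then show "\<psi> \<in> Irr G - ?L" using \<phi> c twist_in_Irr[OF \<phi>(1)] by (auto simp: linear_characters_def)
  qed
  have zeros: "zero_classes \<psi> = zero_classes \<chi>" if "\<psi> \<in> ?O" for \<psi>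
  proof -
    obtain \<phi> where \<phi>: "\<phi> \<in> ?L" "\<psi> = twist \<phi> \<chi>" using \<open>\<psi> \<in> ?O\<close> by blast
    have "\<psi> g = 0 \<longleftrightarrow> \<chi> g = 0" if "g \<in> carrier G" for g
      using norm_linear_character[OF \<phi>(1) that] that by (auto simp: \<phi>(2) twist_def)
    then show ?thesis using Union_conj_classes unfolding zero_classes_def by blast
  qed
  have "card ?L = (\<Sum>\<psi>\<in>?O. card {\<phi> \<in> ?L. twist \<phi> \<chi> = \<psi>})"
    using sum.group[of ?L ?O "\<lambda>\<phi>. twist \<phi> \<chi>" "\<lambda>_. 1 :: nat"] finL by simp
  also have "\<dots> \<le> (\<Sum>\<psi>\<in>?O. card (zero_classes \<psi>) + 1)"
    using card_twist_fibre_le[of \<chi>] c zeros by (intro sum_mono) simp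
  also have "\<dots> = (\<Sum>\<psi>\<in>?O. card (zero_classes \<psi>)) + card ?O" by (simp only: sum.distrib) simp
  also have "\<dots> \<le> nz G + card (Irr G - ?L)"
  proof (rule add_mono)
    show "(\<Sum>\<psi>\<in>?O. card (zero_classes \<psi>)) \<le> nz G"
      unfolding nz_eq using finite_Irr OI by (intro sum_mono2) auto
    show "card ?O \<le> card (Irr G - ?L)"
      using finite_Irr OI by (intro card_mono) auto
  qed
  finally show ?thesis .
qed

lemma card_Irr_le_nz:
  assumes "\<not> comm_group G"
  shows "card (Irr G) \<le> 3 * nz G" "Irr G \<noteq> {}"
proof -
  obtain n \<rho> where r: "irreducible_rep G n \<rho>" "n > 1"
    using nonlinear_irreducible_exists[OF assms] by blast
  let ?\<chi> = "rep_character G \<rho>"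
  have "?\<chi> \<one> = of_nat n"
    using complex_repD(3)[OF irreducible_repD(1)[OF r(1)]] by (simp add: rep_character_def)
  then have c: "?\<chi> \<in> Irr G - linear_characters"
    using rep_character_in_Irr[OF r(1)] r(2) by (auto simp: linear_characters_def)
  have "linear_characters \<subseteq> Irr G" by (auto simp: linear_characters_def)
  then have "card (Irr G - linear_characters) + card linear_characters = card (Irr G)"
    using finite_Irr by (metis add.commute card_Diff_subset card_mono finite_subset le_add_diff_inverse)
  then show "card (Irr G) \<le> 3 * nz G"
    using nz_ge_nonlinear card_linear_characters_le[OF c] by linarith
  show "Irr G \<noteq> {}" using c by blast
qed

end

theorem theoremE:
  fixes G :: "('a, 'b) monoid_scheme"
  assumes "group G" and "finite (carrier G)"
  shows "comm_group G \<longleftrightarrow> anz G < 1 / 3"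
proof -
  interpret finite_group G
    using assms by (simp add: finite_group_def finite_group_axioms_def)
  show ?thesis
  proof
    assume "comm_group G"
    then have "nz G = 0" by (simp add: nz_eq zero_classes_empty_if_abelian)
    then show "anz G < 1 / 3" by (simp add: anz_def)
  next
    assume lt: "anz G < 1 / 3"
    show "comm_group G"
    proof (rule ccontr)
      assume "\<not> comm_group G"
      note k = card_Irr_le_nz[OF this]
      \<comment> \<open>Positivity is essential: division by zero would give \<open>anz G\<close>
        the value 0.\<close>
      have "card (Irr G) > 0" using k(2) finite_Irr by (simp add: card_gt_0_iff)
      moreover have "real (card (Irr G)) \<le> 3 * real (nz G)" using k(1) by linarith
      ultimately have "anz G \<ge> 1 / 3" by (simp add: anz_def field_simps)
      with lt show False by simp
    qed
  qed
qed

end
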